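(* Let $\alpha>1$ and $d=2$. Suppose that for any $\varepsilon>0$ there exists $C_\varepsilon>0$ such that $$\Bigl\|\sup_{0<x_3<R}|Tf(\cdot,x_3)|\Bigr\|_{L^2(B(0,R))}\le C_\varepsilon R^{\frac38+\varepsilon}\|f\|_2$$ for all sufficiently large $R$ and all $f\in L^2(\mathbb R^2)$ with $\operatorname{supp}\widehat f\subset\{\xi\in\mathbb R^2:\frac38\le|\xi|\le\frac{17}8\}$. Then for any $\varepsilon>0$ there exists $C_{\alpha,\varepsilon}>0$ such that $$\Bigl\|\sup_{0<x_3<R^\alpha}|Tf(\cdot,x_3)|\Bigr\|_{L^2(B(0,R))}\le C_{\alpha,\varepsilon}R^{\frac38+\varepsilon}\|f\|_2$$ for all sufficiently large $R$ and all $f\in L^2(\mathbb R^2)$ with $\operatorname{supp}\widehat f\subset\{\xi\in\mathbb R^2:\frac12\le|\xi|\le2\}$.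
   Context: For $f\in L^2(\mathbb R^2)$ with compactly supported Fourier transform, and $x=(x',x_3)\in\mathbb R^2\times\mathbb R$, $$Tf(x)=Tf(x',x_3)=\int_{\mathbb R^2}e^{i[x'\cdot\xi+x_3|\xi|^\alpha]}\widehat f(\xi)\,d\xi .$$ $B(0,R)$ is the ball of radius $R$ in $\mathbb R^2$ centered at the origin. *)

theory Defs
  imports "HOL-Analysis.Analysis"
begin

text \<open>
  The \<open>L\<^sup>2\<close> norm of a nonnegative function, with values in \<open>[0, \<infinity>]\<close>. The case distinction extends
  the square root by \<open>sqrt \<infinity> = \<infinity>\<close>.
\<close>
definition L2_norm :: "'a measure \<Rightarrow> ('a \<Rightarrow> ennreal) \<Rightarrow> ennreal" where
  "L2_norm M F =
    (let I = (\<integral>\<^sup>+x. (F x)\<^sup>2 \<partial>M) in if I = \<infinity> then \<infinity> else ennreal (sqrt (enn2real I)))"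

abbreviation cL2_norm :: "('a::euclidean_space \<Rightarrow> complex) \<Rightarrow> ennreal" where
  "cL2_norm f \<equiv> L2_norm lborel (\<lambda>x. ennreal (cmod (f x)))"

text \<open>
  Functions rather than equivalence classes; every class in \<open>L\<^sup>2\<close> has a Borel measurable
  representative.
\<close>
definition L2 :: "('a::euclidean_space \<Rightarrow> complex) set" where
  "L2 = {f \<in> borel_measurable lborel. cL2_norm f < \<infinity>}"

text \<open>
  The Fourier transform on \<open>L\<^sup>2\<close>, with the normalisation
  \<open>\<integral> e\<^bsup>-i x \<bullet> \<xi>\<^esup> f x dx\<close> on integrable functions. A function in \<open>L\<^sup>2\<close> need not be
  integrable, so its transform is the limit in \<open>L\<^sup>2\<close>, as \<open>r \<rightarrow> \<infinity>\<close>, of the transforms of its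
  truncations to the balls of radius \<open>r\<close>.
\<close>
definition has_fourier_transform ::
    "('a::euclidean_space \<Rightarrow> complex) \<Rightarrow> ('a \<Rightarrow> complex) \<Rightarrow> bool" where
  "has_fourier_transform f g \<longleftrightarrow> g \<in> L2 \<and>
    ((\<lambda>r::real. cL2_norm (\<lambda>\<xi>. g \<xi> - (LINT x:cball 0 r|lborel. cis (- (x \<bullet> \<xi>)) * f x)))
      \<longlongrightarrow> 0) at_top"

text \<open>
  By Plancherel's theorem, the transform of a function in \<open>L\<^sup>2\<close> exists and is unique up to null sets.
\<close>
definition fourier :: "('a::euclidean_space \<Rightarrow> complex) \<Rightarrow> 'a \<Rightarrow> complex" where
  "fourier f = (SOME g. has_fourier_transform f g)"

text \<open>
  The support in the almost-everywhere sense: it depends only on the class of \<open>g\<close> modulo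
  equality almost everywhere, and is the usual support when \<open>g\<close> is continuous.
\<close>
definition ess_supp :: "('a::euclidean_space \<Rightarrow> complex) \<Rightarrow> 'a set" where
  "ess_supp g = - \<Union>{U. open U \<and> (AE \<xi> in lborel. \<xi> \<in> U \<longrightarrow> g \<xi> = 0)}"

definition T :: "real \<Rightarrow> (real^2 \<Rightarrow> complex) \<Rightarrow> real^2 \<Rightarrow> real \<Rightarrow> complex" where
  "T \<alpha> f x' x3 = (LINT \<xi>|lborel. cis (x' \<bullet> \<xi> + x3 * norm \<xi> powr \<alpha>) * fourier f \<xi>)"

definition maximal_T :: "real \<Rightarrow> (real^2 \<Rightarrow> complex) \<Rightarrow> real \<Rightarrow> real^2 \<Rightarrow> ennreal" where
  "maximal_T \<alpha> f h x' = (SUP x3\<in>{0<..<h}. ennreal (cmod (T \<alpha> f x' x3)))"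

end

theory Submission
  imports Defs "HOL-Probability.Characteristic_Functions"
begin

text \<open>
  Write \<open>\<phi> \<xi> = norm \<xi> powr \<alpha>\<close>, let \<open>h\<close> be the Fourier transform of \<open>f\<close>, and let \<open>\<kappa>\<close> be
  a bump of radius \<open>r = 1 / (8 R)\<close> in frequency. Its inverse transform \<open>\<psi>\<close> is comparable to
  \<open>r\<^sup>2\<close> on \<open>B(0, R)\<close>, so it suffices to bound \<open>\<psi> \<cdot> Tf\<close>. By Duhamel's formula on the window
  \<open>[t - R, t]\<close>, \<open>\<psi> \<cdot> Tf (\<cdot>, t)\<close> is an integral over \<open>s\<close> of \<open>T g\<^sub>s (\<cdot>, t - s)\<close>, where the transform of
  \<open>g\<^sub>s\<close> is \<open>\<integral> b \<xi> \<eta> e\<^bsup>i s \<phi> \<eta>\<^esup> h \<eta> d\<eta>\<close> with \<open>b\<close> either \<open>\<kappa> (\<xi> - \<eta>) / R\<close> or the commutator kernel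
  \<open>\<kappa> (\<xi> - \<eta>) (\<phi> \<eta> - \<phi> \<xi>)\<close>; both are \<open>O(1/R)\<close>. As \<open>0 < t - s < R\<close>, the hypothesis applies to
  each \<open>g\<^sub>s\<close>. By Cauchy-Schwarz in \<open>s\<close> the square of the maximal function is at most \<open>R\<close> times an
  integral over all \<open>s\<close> which no longer depends on \<open>t\<close>, and the local smoothing estimate
  \<open>\<integral> \<parallel>g\<^sub>s\<parallel>\<^sup>2 ds = O(r\<^sup>5 \<parallel>f\<parallel>\<^sup>2)\<close>, which holds because \<open>\<nabla>\<phi>\<close> does not vanish on the annulus, closes the
  argument. The supremum may even run over all times.
\<close>

section \<open>Gaussian kernels and dilations\<close>

text \<open>The obstacle is the length of the time interval. The hypothesis covers times up to
  \<open>R\<close>; cutting an interval of length \<open>R powr \<alpha>\<close> into pieces of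
  length \<open>R\<close> and adding the squares of the pieces naively would lose
  \<open>R powr (\<alpha> - 1)\<close> in the square. Heuristically, waves with frequencies in the
  annulus have speed bounded below and leave a ball of radius \<open>R\<close> in time
  \<open>O(R)\<close>, so each contributes to boundedly many pieces. Local smoothing is the
  quantitative form of this.

  The powers of \<open>r\<close> balance exactly: dividing by the square of the spatial weight costs
  \<open>r^-4\<close>, Cauchy-Schwarz costs \<open>R = 1 / (8 r)\<close>, and local smoothing
  returns \<open>r^5\<close>, namely \<open>r^2\<close> from the squared size of the kernels,
  \<open>r^2\<close> from the area of the frequency ball and \<open>r\<close> from thin
  neighbourhoods of circles in it. Hence neither a power of \<open>R\<close> nor any part of
  \<epsilon> is lost.

  The Fourier analysis rests on Gaussian integrals and Bessel's inequality. One-sided estimates with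
  crude constants suffice, because constants are absorbed in \<open>C\<close>.\<close>

definition gauss_kernel :: "real \<Rightarrow> 'a::euclidean_space \<Rightarrow> real" where
  "gauss_kernel s z = (\<Prod>b\<in>Basis. normal_density 0 s (z \<bullet> b))"

lemma cis_measurable[measurable]: "cis \<in> borel_measurable borel"
  by (intro borel_measurable_continuous_onI continuous_intros)

lemma cnj_measurable[measurable]: "cnj \<in> borel_measurable borel"
  by (intro borel_measurable_continuous_onI continuous_intros)

text \<open>\<open>lborel\<close> is the image of the product of the one-dimensional measures under
  the coordinate map, so Fubini for finite products applies.\<close>

lemma integral_lborel_prod:
  fixes f :: "'a::euclidean_space \<Rightarrow> real \<Rightarrow> complex"
  assumes "\<And>b. b \<in> Basis \<Longrightarrow> integrable lborel (f b)"
  shows "integrable lborel (\<lambda>x. \<Prod>b\<in>Basis. f b (x \<bullet> b))"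
    and "(LINT x|lborel. (\<Prod>b\<in>Basis. f b (x \<bullet> b))) = (\<Prod>b\<in>Basis. (LINT t|lborel. f b t))"
proof -
  interpret product_sigma_finite "\<lambda>_::'a. lborel :: real measure" ..
  have m[measurable]: "f b \<in> borel_measurable borel" if "b \<in> Basis" for b
    using borel_measurable_integrable[OF assms[OF that]] by simp
  have comp: "(\<Sum>b'\<in>Basis. g b' *\<^sub>R b') \<bullet> b = g b" if "b \<in> Basis" for b :: 'a and g
    using that by (simp add: inner_sum_left_Basis)
  have E: "integrable (\<Pi>\<^sub>M b\<in>Basis. lborel) (\<lambda>g. \<Prod>b\<in>Basis. f b (g b))"
    by (intro product_integrable_prod assms) auto
  then show "integrable lborel (\<lambda>x. \<Prod>b\<in>Basis. f b (x \<bullet> b))"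
    by (subst lborel_eq, subst integrable_distr_eq) (auto simp: comp)
  have "(LINT x|lborel. (\<Prod>b\<in>Basis. f b (x \<bullet> b))) =
      (LINT g|(\<Pi>\<^sub>M b\<in>Basis. lborel). (\<Prod>b\<in>Basis. f b (g b)))"
    by (subst lborel_eq, subst integral_distr) (auto simp: comp)
  also have "\<dots> = (\<Prod>b\<in>Basis. (LINT t|lborel. f b t))"
    by (intro product_integral_prod assms) auto
  finally show "(LINT x|lborel. (\<Prod>b\<in>Basis. f b (x \<bullet> b))) = (\<Prod>b\<in>Basis. (LINT t|lborel. f b t))" .
qed

text \<open>The substitution \<open>x = s * y\<close> reduces this to the characteristic function of
  the standard normal distribution. A Gaussian of width \<open>1/s\<close> thus becomes a normal
  density of standard deviation \<open>s\<close>.\<close>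

lemma fourier_gaussian_real:
  fixes s z :: real
  assumes "s > 0"
  shows "integrable lborel (\<lambda>y. exp (- (s * y)\<^sup>2 / 2) * cis (y * z))" (is ?I)
    and "(LINT y|lborel. exp (- (s * y)\<^sup>2 / 2) * cis (y * z)) = complex_of_real (2 * pi * normal_density 0 s z)"
proof -
  define F where "F = (\<lambda>x. complex_of_real (exp (- x\<^sup>2 / 2)) * cis (x * (z / s)))"
  have "integrable lborel std_normal_density"
    by (intro integrable_normal_density) auto
  from integrable_mult_right[OF this, of "sqrt (2 * pi)"]
  have "integrable lborel (\<lambda>x. exp (- x\<^sup>2 / 2) :: real)"
    by (simp add: normal_density_def)
  then have F: "integrable lborel F"
    unfolding F_def by (rule Bochner_Integration.integrable_bound) (auto simp: norm_mult)
  have "exp (- (z / s)\<^sup>2 / 2) = char std_normal_distribution (z / s)"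
    by (simp add: char_std_normal_distribution)
  also have "\<dots> = (LINT x|lborel. std_normal_density x *\<^sub>R iexp (z / s * x))"
    unfolding char_def by (subst integral_density) (auto simp: normal_density_nonneg)
  also have "\<dots> = (LINT x|lborel. complex_of_real (1 / sqrt (2 * pi)) * F x)"
    by (intro Bochner_Integration.integral_cong)
       (auto simp: F_def normal_density_def scaleR_conv_of_real cis_conv_exp mult_ac exp_of_real)
  finally have LF: "(LINT x|lborel. F x) = complex_of_real (sqrt (2 * pi) * exp (- (z / s)\<^sup>2 / 2))"
    by (simp add: field_simps exp_of_real[symmetric])
  have eq: "(\<lambda>y. exp (- (s * y)\<^sup>2 / 2) * cis (y * z)) = (\<lambda>y. F (0 + s * y))"
    using assms by (auto simp: F_def)
  show ?I unfolding eq using lborel_integrable_real_affine[OF F, of s 0] assms by simp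
  have "(LINT y|lborel. F y) = \<bar>s\<bar> *\<^sub>R (LINT y|lborel. F (0 + s * y))"
    by (rule lborel_integral_real_affine) (use assms in auto)
  then have "(LINT y|lborel. F (0 + s * y)) = complex_of_real (sqrt (2 * pi) * exp (- (z / s)\<^sup>2 / 2) / s)"
    using LF assms by (simp add: scaleR_conv_of_real field_simps)
  also have "sqrt (2 * pi) * exp (- (z / s)\<^sup>2 / 2) / s = 2 * pi * normal_density 0 s z"
    using assms by (simp add: normal_density_def real_sqrt_mult field_simps power_divide)
  finally show "(LINT y|lborel. exp (- (s * y)\<^sup>2 / 2) * cis (y * z)) = complex_of_real (2 * pi * normal_density 0 s z)"
    unfolding eq .
qed

lemma cis_sum: "finite A \<Longrightarrow> cis (\<Sum>a\<in>A. f a) = (\<Prod>a\<in>A. cis (f a))"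
  by (induction A rule: finite_induct) (auto simp: cis_mult[symmetric])

lemma gaussian_eq_prod:
  fixes y :: "'a::euclidean_space"
  shows "exp (- (s * norm y)\<^sup>2 / 2) = (\<Prod>b\<in>Basis. exp (- (s * (y \<bullet> b))\<^sup>2 / 2 :: real))"
proof -
  have "(s * norm y)\<^sup>2 = (\<Sum>b\<in>Basis. (s * (y \<bullet> b))\<^sup>2)"
    unfolding power_mult_distrib power2_norm_eq_inner euclidean_inner[of y y]
    by (simp add: sum_distrib_left power2_eq_square)
  then show ?thesis
    by (simp add: exp_sum[symmetric] sum_divide_distrib sum_negf)
qed

lemma fourier_gaussian:
  fixes z :: "'a::euclidean_space"
  assumes "s > 0"
  shows "integrable lborel (\<lambda>y. exp (- (s * norm y)\<^sup>2 / 2) * cis (y \<bullet> z))"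
    and "(LINT y|lborel. exp (- (s * norm y)\<^sup>2 / 2) * cis (y \<bullet> z))
      = complex_of_real ((2 * pi) ^ DIM('a) * gauss_kernel s z)"
proof -
  have eq: "(\<lambda>y. complex_of_real (exp (- (s * norm y)\<^sup>2 / 2)) * cis (y \<bullet> z)) =
     (\<lambda>y. \<Prod>b\<in>Basis. complex_of_real (exp (- (s * (y \<bullet> b))\<^sup>2 / 2)) * cis (y \<bullet> b * (z \<bullet> b)))"
    by (simp only: gaussian_eq_prod euclidean_inner[of _ z] cis_sum prod.distrib of_real_prod finite_Basis)
  show "integrable lborel (\<lambda>y. exp (- (s * norm y)\<^sup>2 / 2) * cis (y \<bullet> z))"
    unfolding eq using assms by (intro integral_lborel_prod(1) fourier_gaussian_real(1))
  have "(LINT y|lborel. exp (- (s * norm y)\<^sup>2 / 2) * cis (y \<bullet> z)) =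
     (\<Prod>b\<in>Basis. complex_of_real (2 * pi * normal_density 0 s (z \<bullet> b)))"
    unfolding eq by (rule trans[OF integral_lborel_prod(2)[OF fourier_gaussian_real(1)[OF assms]]])
       (simp only: fourier_gaussian_real(2)[OF assms])
  also have "\<dots> = complex_of_real ((2 * pi) ^ DIM('a) * gauss_kernel s z)"
    unfolding of_real_prod[symmetric] gauss_kernel_def prod.distrib prod_constant
    by (simp only: power_mult_distrib)
  finally show "(LINT y|lborel. exp (- (s * norm y)\<^sup>2 / 2) * cis (y \<bullet> z))
      = complex_of_real ((2 * pi) ^ DIM('a) * gauss_kernel s z)" .
qed

lemma gaussian_integrable:
  assumes "s > 0"
  shows "integrable lborel (\<lambda>y::'a::euclidean_space. exp (- (s * norm y)\<^sup>2 / 2) :: real)"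
  using integrable_norm[OF fourier_gaussian(1)[OF assms, of "0::'a"]] by (simp add: norm_mult)

lemma gauss_kernel_nonneg: "gauss_kernel s z \<ge> 0"
  by (auto simp: gauss_kernel_def intro!: prod_nonneg normal_density_nonneg)

lemma gauss_kernel_minus: "gauss_kernel s (- z) = gauss_kernel s z"
  by (simp add: gauss_kernel_def normal_density_def)

lemma gauss_kernel_commute: "gauss_kernel s (x - y) = gauss_kernel s (y - x)"
  using gauss_kernel_minus[of s "x - y"] by simp

lemma gauss_kernel_measurable[measurable]: "gauss_kernel s \<in> borel_measurable borel"
  unfolding gauss_kernel_def by measurable

text \<open>Used in the inversion theorem to move the width from the kernel into the argument of the
  other function.\<close>

lemma gauss_kernel_scale:
  assumes "s > 0"
  shows "s ^ DIM('a) * gauss_kernel s (s *\<^sub>R z) = gauss_kernel 1 (z :: 'a::euclidean_space)"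
proof -
  have "s * normal_density 0 s (s * t) = std_normal_density t" for t
    using assms by (simp add: normal_density_def real_sqrt_mult power_mult_distrib field_simps)
  then show ?thesis
    by (simp add: gauss_kernel_def prod_constant[symmetric] prod.distrib[symmetric] del: prod_constant)
qed

lemma nn_integral_gauss_kernel:
  assumes "s > 0"
  shows "(\<integral>\<^sup>+z. ennreal (gauss_kernel s (z :: 'a::euclidean_space)) \<partial>lborel) = 1"
proof -
  have "(\<integral>\<^sup>+t. ennreal (normal_density 0 s t) \<partial>lborel) = 1"
    using assms by (subst nn_integral_eq_integral) (auto simp: integrable_normal_density integral_normal_density)
  then have "(\<integral>\<^sup>+z. (\<Prod>b\<in>Basis. ennreal (normal_density 0 s ((z::'a) \<bullet> b))) \<partial>lborel) = 1"
    by (subst nn_integral_lborel_prod) auto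
  then show ?thesis by (simp add: gauss_kernel_def prod_ennreal normal_density_nonneg)
qed

lemma gauss_kernel_integrable:
  assumes "s > 0"
  shows "integrable lborel (gauss_kernel s :: 'a::euclidean_space \<Rightarrow> real)"
    and "(LINT z|lborel. gauss_kernel s (z :: 'a)) = 1"
proof -
  have "has_bochner_integral lborel (gauss_kernel s :: 'a \<Rightarrow> real) 1"
    using nn_integral_gauss_kernel[OF assms, where 'a = 'a]
    by (intro has_bochner_integral_nn_integral) (auto simp: gauss_kernel_nonneg)
  then show "integrable lborel (gauss_kernel s :: 'a \<Rightarrow> real)"
    "(LINT z|lborel. gauss_kernel s (z :: 'a)) = 1"
    by (auto simp: has_bochner_integral_iff)
qed

lemma lborel_scale:
  assumes "c > 0"
  shows "(lborel :: 'a::euclidean_space measure) =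
    density (distr lborel borel (\<lambda>x. t + c *\<^sub>R x)) (\<lambda>_. ennreal (c ^ DIM('a)))"
proof -
  have "t + (\<Sum>j\<in>Basis. (c * (x \<bullet> j)) *\<^sub>R j) = t + c *\<^sub>R x" for x t :: 'a
    by (subst (2) euclidean_representation[of x, symmetric]) (simp add: scaleR_sum_right)
  then show ?thesis
    using lborel_affine_euclidean[of "\<lambda>_. c" t] assms by (simp add: prod_constant)
qed

lemma nn_integral_lborel_scale:
  fixes f :: "'a::euclidean_space \<Rightarrow> ennreal"
  assumes "c > 0" and [measurable]: "f \<in> borel_measurable borel"
  shows "(\<integral>\<^sup>+x. f x \<partial>lborel) = ennreal (c ^ DIM('a)) * (\<integral>\<^sup>+x. f (t + c *\<^sub>R x) \<partial>lborel)"
  by (subst lborel_scale[OF assms(1), of t])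
     (simp add: nn_integral_density nn_integral_distr nn_integral_cmult)

lemma integral_lborel_scale:
  fixes f :: "'a::euclidean_space \<Rightarrow> 'b::{banach, second_countable_topology}"
  assumes "c > 0" and [measurable]: "f \<in> borel_measurable borel"
  shows "(LINT x|lborel. f x) = c ^ DIM('a) *\<^sub>R (LINT x|lborel. f (t + c *\<^sub>R x))"
  using assms(1)
  by (subst lborel_scale[OF assms(1), of t]) (simp add: integral_density integral_distr)

lemma lborel_uminus: "distr lborel borel (uminus :: 'a::euclidean_space \<Rightarrow> 'a) = lborel"
proof -
  have "t + (\<Sum>j\<in>Basis. (- 1 * (x \<bullet> j)) *\<^sub>R j) = t - x" for x t :: 'a
    by (subst (2) euclidean_representation[of x, symmetric]) (simp add: sum_negf)
  then show ?thesis
    using lborel_affine_euclidean[of "\<lambda>_::'a. - 1" 0]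
    by (simp add: density_1 one_ennreal_def[symmetric])
qed

lemma nn_integral_lborel_shift:
  fixes f :: "'a::euclidean_space \<Rightarrow> ennreal"
  assumes [measurable]: "f \<in> borel_measurable borel"
  shows "(\<integral>\<^sup>+x. f (t + x) \<partial>lborel) = (\<integral>\<^sup>+x. f x \<partial>lborel)"
    and "(\<integral>\<^sup>+x. f (t - x) \<partial>lborel) = (\<integral>\<^sup>+x. f x \<partial>lborel)"
proof -
  show *: "(\<integral>\<^sup>+x. f (t + x) \<partial>lborel) = (\<integral>\<^sup>+x. f x \<partial>lborel)" for t
    using nn_integral_lborel_scale[of 1 f t] by simp
  have "(\<integral>\<^sup>+x. f (t - x) \<partial>lborel) = (\<integral>\<^sup>+x. f (t - x) \<partial>distr lborel borel uminus)"
    by (simp add: lborel_uminus)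
  also have "\<dots> = (\<integral>\<^sup>+x. f (t + x) \<partial>lborel)"
    by (subst nn_integral_distr) auto
  finally show "(\<integral>\<^sup>+x. f (t - x) \<partial>lborel) = (\<integral>\<^sup>+x. f x \<partial>lborel)" using * by simp
qed

lemma integral_lborel_shift:
  fixes f :: "'a::euclidean_space \<Rightarrow> 'b::{banach, second_countable_topology}"
  assumes "f \<in> borel_measurable borel"
  shows "(LINT x|lborel. f (t + x)) = (LINT x|lborel. f x)"
  using integral_lborel_scale[of 1 f t] assms by simp

text \<open>Supplies the dominating functions, a product of one function of each variable, for the
  exchanges of integrals below.\<close>

lemma pair_mult_integrable:
  fixes f :: "'a::euclidean_space \<Rightarrow> real" and g :: "'b::euclidean_space \<Rightarrow> real"
  assumes f: "integrable lborel f" and g: "integrable lborel g"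
  shows "integrable (lborel \<Otimes>\<^sub>M lborel) (\<lambda>p. f (fst p) * g (snd p))"
proof (rule lborel_pair.Fubini_integrable)
  have [measurable]: "f \<in> borel_measurable borel" "g \<in> borel_measurable borel"
    using borel_measurable_integrable[OF f] borel_measurable_integrable[OF g] by auto
  show "(\<lambda>p. f (fst p) * g (snd p)) \<in> borel_measurable (lborel \<Otimes>\<^sub>M lborel)" by measurable
  show "integrable lborel (\<lambda>x. LINT y|lborel. norm (f (fst (x, y)) * g (snd (x, y))))"
    using f by (simp add: abs_mult)
  show "AE x in lborel. integrable lborel (\<lambda>y. f (fst (x, y)) * g (snd (x, y)))"
    using g by (intro AE_I2) simp
qed

section \<open>The Fourier transform on square integrable functions\<close>

text \<open>
  A Gaussian factor \<open>exp (- (s * norm y)\<^sup>2 / 2)\<close> is inserted in the left-hand side. Expanding the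
  square and integrating in \<open>y\<close> first turns it into a quadratic form in \<open>k\<close> with kernel
  \<open>gauss_kernel s (\<Phi> \<eta> - \<Phi> \<eta>')\<close>, to which Schur's test applies uniformly in \<open>s\<close>. For
  \<open>\<Phi> \<eta> = - \<eta>\<close> this is Bessel's inequality for the Fourier transform.
\<close>
lemma schur_oscillatory:
  fixes \<Phi> :: "'a::euclidean_space \<Rightarrow> 'b::euclidean_space" and k :: "'a \<Rightarrow> complex"
  assumes [measurable]: "\<Phi> \<in> borel_measurable borel" "S \<in> sets borel"
    and k: "integrable lborel k" "\<And>\<eta>. \<eta> \<notin> S \<Longrightarrow> k \<eta> = 0"
    and bound: "\<And>s \<eta>. s > 0 \<Longrightarrow> \<eta> \<in> S \<Longrightarrow>
      (\<integral>\<^sup>+\<eta>'. ennreal (gauss_kernel s (\<Phi> \<eta> - \<Phi> \<eta>')) * indicator S \<eta>' \<partial>lborel) \<le> ennreal C"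
  shows "(\<integral>\<^sup>+y. ennreal ((cmod (LINT \<eta>|lborel. k \<eta> * cis (y \<bullet> \<Phi> \<eta>)))\<^sup>2) \<partial>lborel)
    \<le> ennreal ((2 * pi) ^ DIM('b) * C) * (\<integral>\<^sup>+\<eta>. ennreal ((cmod (k \<eta>))\<^sup>2) \<partial>lborel)"
proof -
  define I where "I = (\<lambda>y. LINT \<eta>|lborel. k \<eta> * cis (y \<bullet> \<Phi> \<eta>))"
  \<comment> \<open>The pair of frequencies is packed into one measure, so that the triple integral
    in \<open>y\<close> and both frequencies needs only Fubini for two factors.\<close>
  define P where "P = (lborel \<Otimes>\<^sub>M lborel :: ('a \<times> 'a) measure)"
  define W where "W = (\<lambda>p::'a \<times> 'a. k (fst p) * cnj (k (snd p)))"
  define D where "D = (\<lambda>p::'a \<times> 'a. \<Phi> (fst p) - \<Phi> (snd p))"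
  define N where "N = (\<integral>\<^sup>+\<eta>. ennreal ((cmod (k \<eta>))\<^sup>2) \<partial>lborel)"
  interpret P: sigma_finite_measure P
    unfolding P_def by unfold_locales
  interpret Q: pair_sigma_finite "lborel :: 'b measure" P ..
  have km[measurable]: "k \<in> borel_measurable borel"
    using borel_measurable_integrable[OF k(1)] by simp
  have sP[measurable_cong]: "sets P = sets (borel \<Otimes>\<^sub>M borel)"
    unfolding P_def by (intro sets_pair_measure_cong) auto
  have Im[measurable]: "I \<in> borel_measurable borel"
    unfolding I_def by measurable
  have Wm[measurable]: "W \<in> borel_measurable P" and Dm[measurable]: "D \<in> borel_measurable P"
    unfolding W_def D_def P_def by measurable
  have kc: "integrable lborel (\<lambda>\<eta>. k \<eta> * cis (y \<bullet> \<Phi> \<eta>))" for y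
    by (rule Bochner_Integration.integrable_bound[OF k(1)]) (auto simp: norm_mult)
  have "integrable P (\<lambda>p. k (fst p) * cnj (k (snd p)))"
    unfolding P_def
  proof (rule lborel_pair.Fubini_integrable)
    have "(\<lambda>x. LINT y|lborel. cmod (k x) * cmod (k y)) = (\<lambda>x. cmod (k x) * (LINT y|lborel. cmod (k y)))"
      by simp
    then show "integrable lborel (\<lambda>x. LINT y|lborel. norm (k (fst (x, y)) * cnj (k (snd (x, y)))))"
      using k(1) by (simp add: norm_mult)
  qed (use k(1) in auto)
  then have W: "integrable P W" by (simp add: W_def)
  have Wc: "integrable P (\<lambda>p. W p * cis (y \<bullet> D p))" for y
    by (rule Bochner_Integration.integrable_bound[OF W]) (auto simp: norm_mult)
  have I2: "complex_of_real ((cmod (I y))\<^sup>2) = (LINT p|P. W p * cis (y \<bullet> D p))" for y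
  proof -
    have "(LINT p|P. W p * cis (y \<bullet> D p)) =
       (LINT \<eta>|lborel. LINT \<eta>'|lborel. W (\<eta>, \<eta>') * cis (y \<bullet> D (\<eta>, \<eta>')))"
      using Wc unfolding P_def by (intro lborel_pair.integral_fst'[symmetric])
    also have "\<dots> = (LINT \<eta>|lborel. LINT \<eta>'|lborel. (k \<eta> * cis (y \<bullet> \<Phi> \<eta>)) * cnj (k \<eta>' * cis (y \<bullet> \<Phi> \<eta>')))"
      by (intro Bochner_Integration.integral_cong)
         (auto simp: W_def D_def cis_cnj cis_mult[symmetric] inner_diff_right cis_divide[symmetric] divide_inverse mult_ac)
    also have "\<dots> = I y * cnj (I y)"
      by (simp add: I_def integral_cnj[symmetric] del: complex_cnj_mult)
    finally show ?thesis by (simp only: complex_norm_square)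
  qed
  have Ib: "cmod (I y) \<le> (LINT \<eta>|lborel. cmod (k \<eta>))" for y
    unfolding I_def using integral_norm_bound[of lborel "\<lambda>\<eta>. k \<eta> * cis (y \<bullet> \<Phi> \<eta>)"]
    by (simp add: norm_mult)
  have main: "(\<integral>\<^sup>+y. ennreal (exp (- (s * norm y)\<^sup>2 / 2) * (cmod (I y))\<^sup>2) \<partial>lborel)
     \<le> ennreal ((2 * pi) ^ DIM('b) * C) * N" if s: "s > 0" for s
  proof -
    let ?g = "\<lambda>y::'b. exp (- (s * norm y)\<^sup>2 / 2)"
    let ?H = "\<lambda>p. W p * complex_of_real ((2 * pi) ^ DIM('b) * gauss_kernel s (D p))"
    \<comment> \<open>This is what the Gaussian factor is for: it makes the integrand integrable in
      \<open>y\<close>, where \<open>cis\<close> alone has modulus one.\<close>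
    have F: "integrable (lborel \<Otimes>\<^sub>M P) (\<lambda>(y, p). ?g y * (W p * cis (y \<bullet> D p)))"
    proof (rule Q.Fubini_integrable)
      show "integrable lborel (\<lambda>y. LINT p|P. norm (case (y, p) of (y, p) \<Rightarrow> ?g y * (W p * cis (y \<bullet> D p))))"
        using gaussian_integrable[OF s, where 'a='b] by (simp add: norm_mult)
      show "AE y in lborel. integrable P (\<lambda>p. case (y, p) of (y, p) \<Rightarrow> ?g y * (W p * cis (y \<bullet> D p)))"
        by (intro AE_I2) (auto intro!: Wc)
    qed measurable
    have "complex_of_real (LINT y|lborel. ?g y * (cmod (I y))\<^sup>2) =
        (LINT y|lborel. complex_of_real (?g y * (cmod (I y))\<^sup>2))"
      by (rule integral_complex_of_real[symmetric])
    also have "\<dots> = (LINT y|lborel. LINT p|P. ?g y * (W p * cis (y \<bullet> D p)))"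
      unfolding of_real_mult I2 by (simp only: integral_mult_right_zero)
    also have "\<dots> = (LINT p|P. LINT y|lborel. ?g y * (W p * cis (y \<bullet> D p)))"
      by (rule Q.Fubini_integral[symmetric, OF F])
    also have "\<dots> = (LINT p|P. W p * (LINT y|lborel. ?g y * cis (y \<bullet> D p)))"
      by (simp only: mult.left_commute[of _ "W _"] integral_mult_right_zero)
    also have "\<dots> = (LINT p|P. ?H p)"
      by (simp only: fourier_gaussian(2)[OF s])
    finally have eq: "complex_of_real (LINT y|lborel. ?g y * (cmod (I y))\<^sup>2) = (LINT p|P. ?H p)" .
    have H: "integrable P ?H"
      using Q.integrable_snd[OF F]
      by (simp only: mult.left_commute[of _ "W _"] fourier_gaussian(2)[OF s] integral_mult_right_zero)
    have gI: "integrable lborel (\<lambda>y. ?g y * (cmod (I y))\<^sup>2)"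
      by (rule Bochner_Integration.integrable_bound[OF integrable_mult_left[OF gaussian_integrable[OF s], of "(LINT \<eta>|lborel. cmod (k \<eta>))\<^sup>2"]])
         (auto simp: abs_mult intro!: mult_left_mono power_mono Ib)
    have "(\<integral>\<^sup>+y. ennreal (?g y * (cmod (I y))\<^sup>2) \<partial>lborel) = ennreal (LINT y|lborel. ?g y * (cmod (I y))\<^sup>2)"
      by (rule nn_integral_eq_integral[OF gI]) auto
    also have "\<dots> \<le> ennreal (norm (LINT p|P. ?H p))"
      unfolding eq[symmetric] by (simp add: ennreal_leI)
    also have "\<dots> \<le> (\<integral>\<^sup>+p. ennreal (norm (?H p)) \<partial>P)"
      by (rule integral_norm_bound_ennreal[OF H])
    \<comment> \<open>The product of the moduli is split by
      \<open>2 * a * b \<le> a\<^sup>2 + b\<^sup>2\<close>. The indicators are arranged so that in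
      each half the inner integral is exactly the one in \<open>bound\<close>.\<close>
    also have "\<dots> \<le> (\<integral>\<^sup>+p. ennreal ((2 * pi) ^ DIM('b) / 2) *
         (ennreal ((cmod (k (fst p)))\<^sup>2) * (ennreal (gauss_kernel s (\<Phi> (fst p) - \<Phi> (snd p))) * indicator S (snd p)) * indicator S (fst p)
        + ennreal ((cmod (k (snd p)))\<^sup>2) * (ennreal (gauss_kernel s (\<Phi> (snd p) - \<Phi> (fst p))) * indicator S (fst p)) * indicator S (snd p)) \<partial>P)"
    proof (intro nn_integral_mono)
      fix p
      show "ennreal (norm (?H p)) \<le> ennreal ((2 * pi) ^ DIM('b) / 2) *
         (ennreal ((cmod (k (fst p)))\<^sup>2) * (ennreal (gauss_kernel s (\<Phi> (fst p) - \<Phi> (snd p))) * indicator S (snd p)) * indicator S (fst p)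
        + ennreal ((cmod (k (snd p)))\<^sup>2) * (ennreal (gauss_kernel s (\<Phi> (snd p) - \<Phi> (fst p))) * indicator S (fst p)) * indicator S (snd p))"
      proof (cases "fst p \<in> S \<and> snd p \<in> S")
        case True
        let ?a = "cmod (k (fst p))" and ?b = "cmod (k (snd p))" and ?K = "gauss_kernel s (D p)"
        have "0 \<le> (?a - ?b)\<^sup>2" by simp
        then have ab: "?a * ?b \<le> (?a\<^sup>2 + ?b\<^sup>2) / 2" by (simp add: power2_diff)
        have "norm (?H p) = (2 * pi) ^ DIM('b) * ?K * (?a * ?b)"
          by (simp add: norm_mult W_def gauss_kernel_nonneg norm_power)
        also have "\<dots> \<le> (2 * pi) ^ DIM('b) * ?K * ((?a\<^sup>2 + ?b\<^sup>2) / 2)"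
          by (intro mult_left_mono ab mult_nonneg_nonneg gauss_kernel_nonneg) auto
        also have "\<dots> = (2 * pi) ^ DIM('b) / 2 * (?a\<^sup>2 * ?K + ?b\<^sup>2 * ?K)"
          by (simp add: field_simps)
        finally have "ennreal (norm (?H p)) \<le> ennreal ((2 * pi) ^ DIM('b) / 2 * (?a\<^sup>2 * ?K + ?b\<^sup>2 * ?K))"
          by (rule ennreal_leI)
        also have "\<dots> = ennreal ((2 * pi) ^ DIM('b) / 2) * (ennreal (?a\<^sup>2) * ennreal ?K + ennreal (?b\<^sup>2) * ennreal ?K)"
          using gauss_kernel_nonneg[of s "D p"] by (simp only: ennreal_mult ennreal_plus zero_le_power2
              mult_nonneg_nonneg divide_nonneg_nonneg zero_le_power pi_ge_zero zero_le_numeral add_nonneg_nonneg)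
        finally show ?thesis using True
          by (simp only: D_def gauss_kernel_commute[of s "\<Phi> (snd p)"] indicator_simps mult_1_right)
      next
        case False
        then have "W p = 0" using k(2) by (auto simp: W_def)
        then show ?thesis by simp
      qed
    qed
    also have "\<dots> = ennreal ((2 * pi) ^ DIM('b) / 2) *
        ((\<integral>\<^sup>+p. ennreal ((cmod (k (fst p)))\<^sup>2) * (ennreal (gauss_kernel s (\<Phi> (fst p) - \<Phi> (snd p))) * indicator S (snd p)) * indicator S (fst p) \<partial>P)
        + (\<integral>\<^sup>+p. ennreal ((cmod (k (snd p)))\<^sup>2) * (ennreal (gauss_kernel s (\<Phi> (snd p) - \<Phi> (fst p))) * indicator S (fst p)) * indicator S (snd p) \<partial>P))"
      unfolding P_def by (simp add: nn_integral_cmult nn_integral_add)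
    also have "(\<integral>\<^sup>+p. ennreal ((cmod (k (fst p)))\<^sup>2) * (ennreal (gauss_kernel s (\<Phi> (fst p) - \<Phi> (snd p))) * indicator S (snd p)) * indicator S (fst p) \<partial>P)
       = (\<integral>\<^sup>+\<eta>. \<integral>\<^sup>+\<eta>'. ennreal ((cmod (k \<eta>))\<^sup>2) * (ennreal (gauss_kernel s (\<Phi> \<eta> - \<Phi> \<eta>')) * indicator S \<eta>') * indicator S \<eta> \<partial>lborel \<partial>lborel)"
      unfolding P_def by (subst lborel.nn_integral_fst[symmetric]) auto
    also have "(\<integral>\<^sup>+p. ennreal ((cmod (k (snd p)))\<^sup>2) * (ennreal (gauss_kernel s (\<Phi> (snd p) - \<Phi> (fst p))) * indicator S (fst p)) * indicator S (snd p) \<partial>P)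
       = (\<integral>\<^sup>+\<eta>. \<integral>\<^sup>+\<eta>'. ennreal ((cmod (k \<eta>))\<^sup>2) * (ennreal (gauss_kernel s (\<Phi> \<eta> - \<Phi> \<eta>')) * indicator S \<eta>') * indicator S \<eta> \<partial>lborel \<partial>lborel)"
      unfolding P_def by (subst lborel_pair.nn_integral_snd[symmetric]) auto
    also have "(\<integral>\<^sup>+\<eta>. \<integral>\<^sup>+\<eta>'. ennreal ((cmod (k \<eta>))\<^sup>2) * (ennreal (gauss_kernel s (\<Phi> \<eta> - \<Phi> \<eta>')) * indicator S \<eta>') * indicator S \<eta> \<partial>lborel \<partial>lborel)
       \<le> (\<integral>\<^sup>+\<eta>. ennreal ((cmod (k \<eta>))\<^sup>2) * ennreal C \<partial>lborel)"
      (is "?X \<le> _")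
    proof (intro nn_integral_mono)
      fix \<eta>
      have "(\<integral>\<^sup>+\<eta>'. ennreal ((cmod (k \<eta>))\<^sup>2) * (ennreal (gauss_kernel s (\<Phi> \<eta> - \<Phi> \<eta>')) * indicator S \<eta>') * indicator S \<eta> \<partial>lborel)
         = ennreal ((cmod (k \<eta>))\<^sup>2) * (\<integral>\<^sup>+\<eta>'. ennreal (gauss_kernel s (\<Phi> \<eta> - \<Phi> \<eta>')) * indicator S \<eta>' \<partial>lborel) * indicator S \<eta>"
        by (simp add: nn_integral_cmult nn_integral_multc)
      also have "\<dots> \<le> ennreal ((cmod (k \<eta>))\<^sup>2) * ennreal C"
        using bound[OF s, of \<eta>] by (auto split: split_indicator intro!: mult_left_mono)
      finally show "(\<integral>\<^sup>+\<eta>'. ennreal ((cmod (k \<eta>))\<^sup>2) * (ennreal (gauss_kernel s (\<Phi> \<eta> - \<Phi> \<eta>')) * indicator S \<eta>') * indicator S \<eta> \<partial>lborel)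
        \<le> ennreal ((cmod (k \<eta>))\<^sup>2) * ennreal C" .
    qed
    also have "\<dots> = N * ennreal C" unfolding N_def by (simp add: nn_integral_multc)
    finally have "(\<integral>\<^sup>+y. ennreal (?g y * (cmod (I y))\<^sup>2) \<partial>lborel)
      \<le> ennreal ((2 * pi) ^ DIM('b) / 2) * (N * ennreal C + N * ennreal C)"
      by (simp add: add_mono mult_left_mono)
    also have "N * ennreal C + N * ennreal C = 2 * (N * ennreal C)" by (simp add: mult_2)
    also have "ennreal ((2 * pi) ^ DIM('b) / 2) * (2 * (N * ennreal C)) = 
       (ennreal ((2 * pi) ^ DIM('b) / 2) * ennreal 2) * (N * ennreal C)" by (simp add: mult_ac)
    also have "ennreal ((2 * pi) ^ DIM('b) / 2) * ennreal 2 = ennreal ((2 * pi) ^ DIM('b))"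
      by (subst ennreal_mult[symmetric]) auto
    finally have "(\<integral>\<^sup>+y. ennreal (?g y * (cmod (I y))\<^sup>2) \<partial>lborel)
      \<le> ennreal ((2 * pi) ^ DIM('b)) * (N * ennreal C)" .
    moreover have "ennreal ((2 * pi) ^ DIM('b) * C) = ennreal ((2 * pi) ^ DIM('b)) * ennreal C"
      by (rule ennreal_mult') simp
    ultimately show ?thesis by (simp only: mult_ac)
  qed
  \<comment> \<open>The Gaussian is removed along \<open>s = 1 / Suc n\<close>. As
    \<open>main\<close> is uniform in \<open>s\<close>, Fatou's lemma is enough.\<close>
  have lim: "(\<lambda>n. ennreal (exp (- (1 / real (Suc n) * norm y)\<^sup>2 / 2) * (cmod (I y))\<^sup>2)) \<longlonglongrightarrow> ennreal ((cmod (I y))\<^sup>2)" for y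
  proof -
    have "(\<lambda>n. exp (- (1 / real (Suc n) * norm y)\<^sup>2 / 2) * (cmod (I y))\<^sup>2) \<longlonglongrightarrow> exp (- (0 * norm y)\<^sup>2 / 2) * (cmod (I y))\<^sup>2"
      by (intro tendsto_intros LIMSEQ_Suc lim_1_over_n) auto
    then show ?thesis by (intro tendsto_ennrealI) simp
  qed
  have "(\<integral>\<^sup>+y. ennreal ((cmod (I y))\<^sup>2) \<partial>lborel) =
     (\<integral>\<^sup>+y. liminf (\<lambda>n. ennreal (exp (- (1 / real (Suc n) * norm y)\<^sup>2 / 2) * (cmod (I y))\<^sup>2)) \<partial>lborel)"
    by (intro nn_integral_cong lim_imp_Liminf[symmetric] lim) auto
  also have "\<dots> \<le> liminf (\<lambda>n. \<integral>\<^sup>+y. ennreal (exp (- (1 / real (Suc n) * norm y)\<^sup>2 / 2) * (cmod (I y))\<^sup>2) \<partial>lborel)"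
    by (intro nn_integral_liminf) measurable
  also have "\<dots> \<le> liminf (\<lambda>n. ennreal ((2 * pi) ^ DIM('b) * C) * N)"
    by (intro Liminf_mono always_eventually allI main) auto
  finally show ?thesis unfolding I_def N_def by (simp add: Liminf_const)
qed

section \<open>Squared norms in place of norms\<close>

abbreviation energy :: "('a::euclidean_space \<Rightarrow> complex) \<Rightarrow> ennreal" where
  "energy f \<equiv> (\<integral>\<^sup>+x. ennreal ((cmod (f x))\<^sup>2) \<partial>lborel)"

text \<open>Confines the case distinction in \<open>L2_norm\<close> to this place: squaring turns it
  into a plain integral, and all later estimates are made for squares.\<close>

lemma L2_norm_power2: "(L2_norm M F)\<^sup>2 = (\<integral>\<^sup>+x. (F x)\<^sup>2 \<partial>M)"
proof (cases "(\<integral>\<^sup>+x. (F x)\<^sup>2 \<partial>M) = \<infinity>")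
  case False
  then show ?thesis
    by (simp add: L2_norm_def Let_def ennreal_power less_top)
qed (simp add: L2_norm_def Let_def power2_eq_square)

lemma cL2_norm_power2: "(cL2_norm f)\<^sup>2 = energy f"
  unfolding L2_norm_power2 by (subst ennreal_power) auto

lemma ennreal_power2_le_iff: "a\<^sup>2 \<le> b\<^sup>2 \<longleftrightarrow> a \<le> (b::ennreal)"
proof
  assume *: "a\<^sup>2 \<le> b\<^sup>2"
  show "a \<le> b"
  proof (cases b)
    case b: (real y)
    show ?thesis
    proof (cases a)
      case a: (real x)
      have "x\<^sup>2 \<le> y\<^sup>2" using * a b by (simp add: ennreal_power)
      then have "x \<le> y" by (rule power2_le_imp_le[OF _ b(1)])
      then show ?thesis using a b by (simp add: ennreal_leI)
    next
      case top
      have "ennreal (y\<^sup>2) = top"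
        using * b by (simp add: top top_unique flip: ennreal_power)
      then show ?thesis by simp
    qed
  qed simp
qed (rule power_mono, simp_all)

lemma L2_iff: "f \<in> L2 \<longleftrightarrow> f \<in> borel_measurable borel \<and> energy f < \<infinity>"
proof -
  have "cL2_norm f < \<infinity> \<longleftrightarrow> energy f < \<infinity>"
    unfolding cL2_norm_power2[symmetric] by (auto simp: power2_eq_square ennreal_mult_less_top)
  then show ?thesis by (simp add: L2_def)
qed

lemma cL2_norm_tendsto_0_iff:
  "((\<lambda>r. cL2_norm (h r)) \<longlongrightarrow> 0) F \<longleftrightarrow> ((\<lambda>r. energy (h r)) \<longlongrightarrow> 0) F"
proof
  assume *: "((\<lambda>r. cL2_norm (h r)) \<longlongrightarrow> 0) F"
  show "((\<lambda>r. energy (h r)) \<longlongrightarrow> 0) F"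
    unfolding cL2_norm_power2[symmetric]
  proof (rule order_tendstoI)
    fix e :: ennreal assume "0 < e"
    \<comment> \<open>The bound by 1 makes the square at most the norm itself, so smallness of the
      norm carries over.\<close>
    then have "\<forall>\<^sub>F r in F. cL2_norm (h r) < min 1 e"
      by (intro order_tendstoD(2)[OF *]) auto
    then show "\<forall>\<^sub>F r in F. (cL2_norm (h r))\<^sup>2 < e"
    proof eventually_elim
      case (elim r)
      then have "cL2_norm (h r) * cL2_norm (h r) \<le> 1 * cL2_norm (h r)"
        by (intro mult_right_mono) auto
      then show ?case using elim by (simp add: power2_eq_square le_less_trans)
    qed
  qed simp
next
  assume *: "((\<lambda>r. energy (h r)) \<longlongrightarrow> 0) F"
  show "((\<lambda>r. cL2_norm (h r)) \<longlongrightarrow> 0) F"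
  proof (rule order_tendstoI)
    fix e :: ennreal assume "0 < e"
    then have "\<forall>\<^sub>F r in F. (cL2_norm (h r))\<^sup>2 < e\<^sup>2"
      unfolding cL2_norm_power2
      by (intro order_tendstoD(2)[OF *]) (auto simp: power2_eq_square ennreal_zero_less_mult_iff)
    then show "\<forall>\<^sub>F r in F. cL2_norm (h r) < e"
      by (rule eventually_mono) (simp only: not_le[symmetric] ennreal_power2_le_iff not_False_eq_True)
  qed simp
qed

text \<open>A substitute for Minkowski's inequality that stays with squares, from
  \<open>(a + b)\<^sup>2 \<le> 2 * a\<^sup>2 + 2 * b\<^sup>2\<close>. The factor 2 multiplies
  quantities that tend to zero or is absorbed in a constant.\<close>

lemma energy_triangle:
  assumes [measurable]: "f \<in> borel_measurable borel" "g \<in> borel_measurable borel" "h \<in> borel_measurable borel"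
  shows "energy (\<lambda>x. f x - h x) \<le> 2 * energy (\<lambda>x. f x - g x) + 2 * energy (\<lambda>x. g x - h x)"
proof -
  have "(cmod (f x - h x))\<^sup>2 \<le> 2 * (cmod (f x - g x))\<^sup>2 + 2 * (cmod (g x - h x))\<^sup>2" for x
  proof -
    have "cmod (f x - h x) \<le> cmod (f x - g x) + cmod (g x - h x)"
      using norm_triangle_ineq[of "f x - g x" "g x - h x"] by simp
    then have "(cmod (f x - h x))\<^sup>2 \<le> (cmod (f x - g x) + cmod (g x - h x))\<^sup>2"
      by (rule power_mono) simp
    also have "\<dots> \<le> 2 * (cmod (f x - g x))\<^sup>2 + 2 * (cmod (g x - h x))\<^sup>2"
      using zero_le_power2[of "cmod (f x - g x) - cmod (g x - h x)"]
      by (simp add: power2_sum power2_diff)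
    finally show ?thesis .
  qed
  then have "energy (\<lambda>x. f x - h x) \<le>
      (\<integral>\<^sup>+x. ennreal (2 * (cmod (f x - g x))\<^sup>2 + 2 * (cmod (g x - h x))\<^sup>2) \<partial>lborel)"
    by (intro nn_integral_mono ennreal_leI)
  also have "\<dots> = 2 * energy (\<lambda>x. f x - g x) + 2 * energy (\<lambda>x. g x - h x)"
    by (subst nn_integral_cmult[symmetric], measurable, subst nn_integral_cmult[symmetric], measurable,
        subst nn_integral_add[symmetric], measurable) (simp add: ennreal_plus ennreal_mult'')
  finally show ?thesis .
qed

lemma energy_minus_commute: "energy (\<lambda>x. f x - g x) = energy (\<lambda>x. g x - f x)"
  by (simp add: norm_minus_commute)

text \<open>On a ball containing the support the modulus is dominated by
  \<open>1 + t\<^sup>2\<close>, whose two terms are integrable there.\<close>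

lemma integrable_if_energy_finite:
  assumes [measurable]: "u \<in> borel_measurable borel" and e: "energy u < \<infinity>"
    and b: "bounded B" "\<And>x. x \<notin> B \<Longrightarrow> u x = (0::complex)"
  shows "integrable lborel (u :: 'a::euclidean_space \<Rightarrow> complex)"
proof -
  obtain a where a: "B \<subseteq> cball 0 a"
    using b(1) unfolding bounded_iff by (meson mem_cball_0 subsetI)
  have "integrable lborel (\<lambda>x. (cmod (u x))\<^sup>2)"
    using e by (intro integrableI_bounded) auto
  moreover have "integrable lborel (\<lambda>x. indicator (cball 0 a :: 'a set) x :: real)"
    using emeasure_lborel_cball_finite[of "0::'a" a] by (intro integrable_real_indicator) auto
  ultimately have "integrable lborel (\<lambda>x. indicator (cball 0 a) x + (cmod (u x))\<^sup>2)"
    by (rule Bochner_Integration.integrable_add[rotated])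
  then show ?thesis
  proof (rule Bochner_Integration.integrable_bound)
    have "t \<le> 1 + t\<^sup>2" for t :: real
      using zero_le_power2[of "t - 1/2"] by (simp add: power2_diff field_simps)
    then show "AE x in lborel. norm (u x) \<le> norm (indicator (cball 0 a) x + (cmod (u x))\<^sup>2)"
      using a b(2) by (intro AE_I2) (force split: split_indicator)
  qed auto
qed

section \<open>Bessel's inequality and truncations\<close>

definition fourier_integral :: "('a::euclidean_space \<Rightarrow> complex) \<Rightarrow> 'a \<Rightarrow> complex" where
  "fourier_integral u \<xi> = (LINT x|lborel. cis (- (x \<bullet> \<xi>)) * u x)"

lemma fourier_integral_measurable[measurable]:
  assumes [measurable]: "u \<in> borel_measurable borel"
  shows "fourier_integral u \<in> borel_measurable borel"
  unfolding fourier_integral_def by measurable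

lemma integrable_cis_mult:
  assumes "integrable M u" "p \<in> borel_measurable M"
  shows "integrable M (\<lambda>x. cis (p x) * u x)"
proof -
  have [measurable]: "p \<in> borel_measurable M" "u \<in> borel_measurable M"
    using assms by auto
  show ?thesis
    by (rule Bochner_Integration.integrable_bound[OF assms(1)]) (auto simp: norm_mult)
qed

lemma fourier_integral_diff:
  assumes "integrable lborel u" "integrable lborel v"
  shows "fourier_integral u \<xi> - fourier_integral v \<xi> = fourier_integral (\<lambda>x. u x - v x) \<xi>"
  unfolding fourier_integral_def right_diff_distrib
  by (intro Bochner_Integration.integral_diff[symmetric] integrable_cis_mult assms) auto

text \<open>In \<open>schur_oscillatory\<close> the phase map is minus the identity, respectively
  the identity, and the Schur constant is the total mass 1 of the Gaussian kernel.\<close>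

lemma bessel:
  fixes u :: "'a::euclidean_space \<Rightarrow> complex"
  assumes u: "integrable lborel u"
  shows "energy (fourier_integral u) \<le> ennreal ((2 * pi) ^ DIM('a)) * energy u"
    and "energy (\<lambda>\<xi>. LINT x|lborel. cis (\<xi> \<bullet> x) * u x) \<le> ennreal ((2 * pi) ^ DIM('a)) * energy u"
proof -
  have K: "(\<integral>\<^sup>+\<eta>'. ennreal (gauss_kernel s (\<eta> - \<eta>')) \<partial>lborel) = 1" if "s > 0" for s and \<eta> :: 'a
  proof -
    have "(\<lambda>x::'a. ennreal (gauss_kernel s x)) \<in> borel_measurable borel" by measurable
    from nn_integral_lborel_shift(2)[OF this, of \<eta>] nn_integral_gauss_kernel[OF that, where 'a = 'a]
    show ?thesis by simp
  qed
  have "energy (\<lambda>y. LINT \<eta>|lborel. u \<eta> * cis (y \<bullet> - \<eta>)) \<le> ennreal ((2 * pi) ^ DIM('a) * 1) * energy u"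
  proof (rule schur_oscillatory[where S = UNIV])
    show "(\<integral>\<^sup>+\<eta>'. ennreal (gauss_kernel s (- \<eta> - - \<eta>')) * indicator UNIV \<eta>' \<partial>lborel) \<le> ennreal 1"
      if "s > 0" for s and \<eta> :: 'a
      using K[OF that, of \<eta>] by (simp add: gauss_kernel_commute[of s _ \<eta>])
  qed (use u in auto)
  moreover have "fourier_integral u = (\<lambda>y. LINT \<eta>|lborel. u \<eta> * cis (y \<bullet> - \<eta>))"
    by (simp add: fourier_integral_def[abs_def] inner_commute mult.commute)
  ultimately show "energy (fourier_integral u) \<le> ennreal ((2 * pi) ^ DIM('a)) * energy u"
    by simp
  have "energy (\<lambda>y. LINT \<eta>|lborel. u \<eta> * cis (y \<bullet> \<eta>)) \<le> ennreal ((2 * pi) ^ DIM('a) * 1) * energy u"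
    by (rule schur_oscillatory[where S = UNIV]) (use u K in auto)
  then show "energy (\<lambda>\<xi>. LINT x|lborel. cis (\<xi> \<bullet> x) * u x) \<le> ennreal ((2 * pi) ^ DIM('a)) * energy u"
    by (simp add: mult.commute)
qed

lemma bessel_diff:
  fixes u v :: "'a::euclidean_space \<Rightarrow> complex"
  assumes "integrable lborel u" "integrable lborel v"
  shows "energy (\<lambda>\<xi>. fourier_integral u \<xi> - fourier_integral v \<xi>)
    \<le> ennreal ((2 * pi) ^ DIM('a)) * energy (\<lambda>x. u x - v x)"
  unfolding fourier_integral_diff[OF assms] by (intro bessel(1) Bochner_Integration.integrable_diff assms)

definition truncate :: "real \<Rightarrow> ('a::euclidean_space \<Rightarrow> complex) \<Rightarrow> 'a \<Rightarrow> complex" where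
  "truncate r f x = indicator (cball 0 r) x *\<^sub>R f x"

lemma truncate_measurable[measurable]:
  "f \<in> borel_measurable borel \<Longrightarrow> truncate r f \<in> borel_measurable borel"
  unfolding truncate_def[abs_def]
  by (intro borel_measurable_scaleR borel_measurable_indicator borel_closed closed_cball) auto

lemma energy_truncate: "energy (truncate r f) \<le> energy f"
  by (intro nn_integral_mono ennreal_leI) (auto simp: truncate_def split: split_indicator)

lemma truncate_integrable:
  assumes "f \<in> L2"
  shows "integrable lborel (truncate r f)"
proof (rule integrable_if_energy_finite)
  show "energy (truncate r f) < \<infinity>"
    using assms energy_truncate[of r f] by (auto simp: L2_iff)
qed (use assms in \<open>auto simp: truncate_def L2_iff split: split_indicator intro: bounded_cball[of 0 r]\<close>)

lemma has_fourier_transform_iff: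
  "has_fourier_transform f g \<longleftrightarrow> g \<in> L2 \<and>
    ((\<lambda>r. energy (\<lambda>\<xi>. g \<xi> - fourier_integral (truncate r f) \<xi>)) \<longlongrightarrow> 0) at_top"
proof -
  have "(LINT x:cball 0 r|lborel. cis (- (x \<bullet> \<xi>)) * f x) = fourier_integral (truncate r f) \<xi>" for r \<xi>
    by (simp add: set_lebesgue_integral_def fourier_integral_def truncate_def)
  then show ?thesis
    unfolding has_fourier_transform_def by (simp only: cL2_norm_tendsto_0_iff)
qed

lemma energy_truncate_tendsto:
  fixes f :: "'a::euclidean_space \<Rightarrow> complex"
  assumes "f \<in> L2"
  shows "((\<lambda>r. energy (\<lambda>x. f x - truncate r f x)) \<longlongrightarrow> 0) at_top"
proof (rule tendsto_at_topI_sequentially)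
  fix X :: "nat \<Rightarrow> real" assume X: "filterlim X at_top sequentially"
  have [measurable]: "f \<in> borel_measurable borel" using assms by (simp add: L2_iff)
  have "(\<lambda>n. energy (\<lambda>x. f x - truncate (X n) f x)) \<longlonglongrightarrow> (\<integral>\<^sup>+x. 0 \<partial>(lborel :: 'a measure))"
  proof (rule nn_integral_dominated_convergence[where w = "\<lambda>x. ennreal ((cmod (f x))\<^sup>2)"])
    show "AE x in lborel. (\<lambda>n. ennreal ((cmod (f x - truncate (X n) f x))\<^sup>2)) \<longlonglongrightarrow> 0"
    proof (intro AE_I2 tendsto_eventually)
      fix x :: 'a
      have "\<forall>\<^sub>F n in sequentially. X n \<ge> norm x" using X by (simp add: filterlim_at_top)
      then show "\<forall>\<^sub>F n in sequentially. ennreal ((cmod (f x - truncate (X n) f x))\<^sup>2) = 0"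
        by eventually_elim (simp add: truncate_def)
    qed
    show "\<And>n. AE x in lborel. ennreal ((cmod (f x - truncate (X n) f x))\<^sup>2) \<le> ennreal ((cmod (f x))\<^sup>2)"
      by (intro AE_I2 ennreal_leI) (auto simp: truncate_def split: split_indicator)
  qed (use assms in \<open>auto simp: L2_iff\<close>)
  then show "(\<lambda>n. energy (\<lambda>x. f x - truncate (X n) f x)) \<longlonglongrightarrow> 0" by simp
qed

text \<open>Bessel's inequality holds for every truncation and passes to the limit; the extra factor
  2 comes from \<open>energy_triangle\<close>.\<close>

lemma energy_has_fourier_transform:
  fixes f :: "'a::euclidean_space \<Rightarrow> complex"
  assumes f: "f \<in> L2" and g: "has_fourier_transform f g"
  shows "energy g \<le> ennreal (2 * (2 * pi) ^ DIM('a)) * energy f"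
proof -
  let ?F = "\<lambda>r. fourier_integral (truncate r f)"
  have [measurable]: "f \<in> borel_measurable borel" "g \<in> borel_measurable borel"
    using f g by (auto simp: L2_iff has_fourier_transform_iff)
  have "energy g \<le> 2 * energy (\<lambda>\<xi>. g \<xi> - ?F r \<xi>) + ennreal (2 * (2 * pi) ^ DIM('a)) * energy f" for r
  proof -
    have "energy (?F r) \<le> ennreal ((2 * pi) ^ DIM('a)) * energy (truncate r f)"
      by (rule bessel(1)[OF truncate_integrable[OF f]])
    also have "\<dots> \<le> ennreal ((2 * pi) ^ DIM('a)) * energy f"
      by (intro mult_left_mono energy_truncate) auto
    finally have "2 * energy (?F r) \<le> 2 * (ennreal ((2 * pi) ^ DIM('a)) * energy f)"
      by (rule mult_left_mono) simp
    also have "\<dots> = ennreal (2 * (2 * pi) ^ DIM('a)) * energy f"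
      by (subst ennreal_mult) (auto simp: mult.assoc)
    finally show ?thesis
      using energy_triangle[of g "?F r" "\<lambda>_. 0"] by (auto intro: order_trans add_left_mono)
  qed
  moreover have "((\<lambda>r. 2 * energy (\<lambda>\<xi>. g \<xi> - ?F r \<xi>) + ennreal (2 * (2 * pi) ^ DIM('a)) * energy f)
      \<longlongrightarrow> 2 * 0 + ennreal (2 * (2 * pi) ^ DIM('a)) * energy f) at_top"
    using g by (intro tendsto_add ennreal_tendsto_cmult tendsto_const) (auto simp: has_fourier_transform_iff)
  ultimately show ?thesis
    by (intro tendsto_lowerbound[where F = at_top and f = "\<lambda>r. 2 * energy (\<lambda>\<xi>. g \<xi> - ?F r \<xi>) + ennreal (2 * (2 * pi) ^ DIM('a)) * energy f"]) auto
qed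

text \<open>The almost everywhere part of the Riesz-Fischer theorem. The weights
  \<open>2 ^ n\<close> leave a convergent sum of energies, so almost everywhere the weighted sum of
  squares is some finite \<open>M\<close>. Each increment is then at most
  \<open>sqrt M * (1 / sqrt 2) ^ n\<close>, and the increments are summable.\<close>

lemma energy_complete:
  fixes F :: "nat \<Rightarrow> 'a::euclidean_space \<Rightarrow> complex"
  assumes [measurable]: "\<And>n. F n \<in> borel_measurable borel"
    and F: "\<And>n. energy (\<lambda>x. F (Suc n) x - F n x) \<le> ennreal (C * (1/4) ^ n)" and "C \<ge> 0"
  shows "AE x in lborel. convergent (\<lambda>n. F n x)"
proof -
  let ?d = "\<lambda>n x. (cmod (F (Suc n) x - F n x))\<^sup>2"
  have "(\<integral>\<^sup>+x. (\<Sum>n. ennreal (2 ^ n) * ennreal (?d n x)) \<partial>lborel) = (\<Sum>n. ennreal (2 ^ n) * energy (\<lambda>x. F (Suc n) x - F n x))"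
    by (simp add: nn_integral_suminf nn_integral_cmult)
  also have "\<dots> \<le> (\<Sum>n. ennreal (C * (1/2) ^ n))"
  proof (intro suminf_le allI)
    fix n
    have "ennreal (2 ^ n) * energy (\<lambda>x. F (Suc n) x - F n x) \<le> ennreal (2 ^ n) * ennreal (C * (1/4) ^ n)"
      by (intro mult_left_mono F) simp
    also have "\<dots> = ennreal (2 ^ n * (C * (1/4) ^ n))"
      by (subst ennreal_mult') auto
    also have "2 ^ n * (C * (1/4) ^ n) = C * (1/2) ^ n"
      by (simp add: power_mult_distrib[symmetric] mult.left_commute)
    finally show "ennreal (2 ^ n) * energy (\<lambda>x. F (Suc n) x - F n x) \<le> ennreal (C * (1/2) ^ n)" .
  qed auto
  also have "\<dots> = ennreal (\<Sum>n. C * (1/2) ^ n)"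
    using \<open>C \<ge> 0\<close> by (intro suminf_ennreal2 summable_mult summable_geometric) auto
  finally have "(\<integral>\<^sup>+x. (\<Sum>n. ennreal (2 ^ n) * ennreal (?d n x)) \<partial>lborel) < \<infinity>"
    by (rule le_less_trans) simp
  then have "AE x in lborel. (\<Sum>n. ennreal (2 ^ n) * ennreal (?d n x)) \<noteq> \<infinity>"
    by (intro nn_integral_PInf_AE) auto
  then show ?thesis
  proof eventually_elim
    case (elim x)
    define M where "M = enn2real (\<Sum>n. ennreal (2 ^ n) * ennreal (?d n x))"
    have M: "(\<Sum>n. ennreal (2 ^ n) * ennreal (?d n x)) = ennreal M"
      using elim by (simp add: M_def less_top)
    have "M \<ge> 0" by (simp add: M_def)
    have "norm (F (Suc n) x - F n x) \<le> sqrt M * (1 / sqrt 2) ^ n" for n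
    proof -
      have "ennreal (2 ^ n * ?d n x) \<le> ennreal M"
        unfolding M[symmetric] using sum_le_suminf[of "\<lambda>n. ennreal (2 ^ n) * ennreal (?d n x)" "{n}"]
        by (simp add: ennreal_mult)
      then have "2 ^ n * ?d n x \<le> M" using \<open>M \<ge> 0\<close> by (simp add: ennreal_le_iff)
      then have "?d n x \<le> M * (1/2) ^ n" by (simp add: field_simps power_divide)
      also have "\<dots> = (sqrt M * (1 / sqrt 2) ^ n)\<^sup>2"
        using \<open>M \<ge> 0\<close> by (simp add: power_mult_distrib power_divide power_mult[symmetric] mult.commute[of n])
          (simp add: power_mult)
      finally show ?thesis
        by (rule power2_le_imp_le) (use \<open>M \<ge> 0\<close> in auto)
    qed
    moreover have "summable (\<lambda>n. sqrt M * (1 / sqrt 2) ^ n)"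
      by (intro summable_mult summable_geometric) (auto simp: real_less_rsqrt)
    ultimately have "summable (\<lambda>n. F (Suc n) x - F n x)"
      by (rule summable_comparison_test'[where N = 0, rotated])
    then have "(\<lambda>n. F 0 x + (\<Sum>k<n. F (Suc k) x - F k x)) \<longlonglongrightarrow> F 0 x + (\<Sum>k. F (Suc k) x - F k x)"
      by (intro tendsto_intros summable_LIMSEQ)
    then have "(\<lambda>n. F n x) \<longlonglongrightarrow> F 0 x + (\<Sum>k. F (Suc k) x - F k x)"
      by (simp add: sum_lessThan_telescope[of "\<lambda>n. F n x"])
    then show "convergent (\<lambda>n. F n x)"
      by (rule convergentI)
  qed
qed

section \<open>Existence and inversion of the Fourier transform\<close>

lemma has_fourier_transform_exists:
  fixes f :: "'a::euclidean_space \<Rightarrow> complex"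
  assumes f: "f \<in> L2"
  shows "has_fourier_transform f (fourier f)"
proof -
  let ?c = "(2 * pi) ^ DIM('a)"
  let ?F = "\<lambda>r. fourier_integral (truncate r f)"
  let ?E = "\<lambda>r. energy (\<lambda>x. f x - truncate r f x)"
  have [measurable]: "f \<in> borel_measurable borel" using f by (simp add: L2_iff)
  have diff: "energy (\<lambda>\<xi>. ?F r \<xi> - ?F r' \<xi>) \<le> ennreal (2 * ?c) * (?E r + ?E r')" for r r'
  proof -
    have "energy (\<lambda>\<xi>. ?F r \<xi> - ?F r' \<xi>) \<le> ennreal ?c * energy (\<lambda>x. truncate r f x - truncate r' f x)"
      by (intro bessel_diff truncate_integrable f)
    also have "\<dots> \<le> ennreal ?c * (2 * energy (\<lambda>x. truncate r f x - f x) + 2 * ?E r')"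
      by (intro mult_left_mono energy_triangle) auto
    also have "\<dots> = ennreal (2 * ?c) * (?E r + ?E r')"
      by (simp add: energy_minus_commute[of "truncate r f" f] distrib_left ennreal_mult mult_ac)
    finally show ?thesis .
  qed
  have "\<exists>r. ?E r \<le> ennreal ((1/4) ^ n)" for n :: nat
  proof -
    have "\<forall>\<^sub>F r in at_top. ?E r < ennreal ((1/4) ^ n)"
      by (intro order_tendstoD(2)[OF energy_truncate_tendsto[OF f]]) auto
    then show ?thesis by (metis (mono_tags, lifting) eventually_at_top_linorder less_imp_le order_refl)
  qed
  \<comment> \<open>Only the rate of decay of the tail energies matters; the radii need not be
    monotone.\<close>
  then obtain X where X: "\<And>n. ?E (X n) \<le> ennreal ((1/4) ^ n)" by metis
  define g where "g = (\<lambda>\<xi>. lim (\<lambda>n. ?F (X n) \<xi>))"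
  have [measurable]: "g \<in> borel_measurable borel"
    unfolding g_def by (rule borel_measurable_lim_metric) measurable
  have "AE \<xi> in lborel. convergent (\<lambda>n. ?F (X n) \<xi>)"
  proof (rule energy_complete)
    fix n
    have "energy (\<lambda>\<xi>. ?F (X (Suc n)) \<xi> - ?F (X n) \<xi>) \<le> ennreal (2 * ?c) * (?E (X (Suc n)) + ?E (X n))"
      by (rule diff)
    also have "\<dots> \<le> ennreal (2 * ?c) * (ennreal ((1/4) ^ Suc n) + ennreal ((1/4) ^ n))"
      by (intro mult_left_mono add_mono X) auto
    also have "\<dots> = ennreal (2 * ?c * ((1/4) ^ Suc n + (1/4) ^ n))"
      by (subst ennreal_plus[symmetric], simp, simp, subst ennreal_mult) auto
    also have "\<dots> \<le> ennreal (4 * ?c * (1/4) ^ n)"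
      by (intro ennreal_leI) simp
    finally show "energy (\<lambda>\<xi>. ?F (X (Suc n)) \<xi> - ?F (X n) \<xi>) \<le> ennreal (4 * ?c * (1/4) ^ n)" .
  qed auto
  then have lim: "AE \<xi> in lborel. (\<lambda>n. ?F (X n) \<xi>) \<longlonglongrightarrow> g \<xi>"
    by eventually_elim (simp add: g_def convergent_LIMSEQ_iff)
  \<comment> \<open>Fatou along the chosen radii turns the Cauchy estimate \<open>diff\<close> into
    a bound for the distance to the limit at every \<open>r\<close>, as the definition of the
    transform demands.\<close>
  have gF: "energy (\<lambda>\<xi>. g \<xi> - ?F r \<xi>) \<le> ennreal (2 * ?c) * ?E r" for r
  proof -
    have "energy (\<lambda>\<xi>. g \<xi> - ?F r \<xi>) = (\<integral>\<^sup>+\<xi>. liminf (\<lambda>n. ennreal ((cmod (?F (X n) \<xi> - ?F r \<xi>))\<^sup>2)) \<partial>lborel)"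
    proof (rule nn_integral_cong_AE)
      show "AE \<xi> in lborel. ennreal ((cmod (g \<xi> - ?F r \<xi>))\<^sup>2) = liminf (\<lambda>n. ennreal ((cmod (?F (X n) \<xi> - ?F r \<xi>))\<^sup>2))"
        using lim by eventually_elim
          (intro lim_imp_Liminf[symmetric] tendsto_ennrealI tendsto_intros, auto)
    qed
    also have "\<dots> \<le> liminf (\<lambda>n. energy (\<lambda>\<xi>. ?F (X n) \<xi> - ?F r \<xi>))"
      by (intro nn_integral_liminf) measurable
    also have "\<dots> \<le> liminf (\<lambda>n. ennreal (2 * ?c) * (ennreal ((1/4) ^ n) + ?E r))"
      by (intro Liminf_mono always_eventually allI order_trans[OF diff] mult_left_mono add_right_mono X) auto
    also have "\<dots> = ennreal (2 * ?c) * (ennreal 0 + ?E r)"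
      by (intro lim_imp_Liminf ennreal_tendsto_cmult tendsto_add tendsto_const tendsto_ennrealI LIMSEQ_power_zero) auto
    finally show ?thesis by simp
  qed
  have "?E r < \<infinity>" for r
  proof -
    have "?E r \<le> energy f"
      by (intro nn_integral_mono ennreal_leI) (auto simp: truncate_def split: split_indicator)
    then show ?thesis using f by (auto simp: L2_iff)
  qed
  then have "energy (\<lambda>\<xi>. g \<xi> - ?F 0 \<xi>) < \<infinity>"
    using gF[of 0] by (intro le_less_trans[OF gF]) (simp add: ennreal_mult_less_top)
  moreover have "energy (?F 0) < \<infinity>"
    using f energy_truncate[of 0 f]
    by (intro le_less_trans[OF bessel(1)[OF truncate_integrable[OF f]]])
       (auto simp: ennreal_mult_less_top L2_iff)
  ultimately have "energy g < \<infinity>"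
    using energy_triangle[of g "?F 0" "\<lambda>_. 0"] by (auto simp: ennreal_mult_less_top elim!: le_less_trans)
  moreover have "((\<lambda>r. energy (\<lambda>\<xi>. g \<xi> - ?F r \<xi>)) \<longlongrightarrow> 0) at_top"
  proof (rule tendsto_sandwich[where f = "\<lambda>_. 0"])
    show "((\<lambda>r. ennreal (2 * ?c) * ?E r) \<longlongrightarrow> 0) at_top"
      using ennreal_tendsto_cmult[OF _ energy_truncate_tendsto[OF f], of "ennreal (2 * ?c)"] by simp
  qed (use gF in auto)
  ultimately have "has_fourier_transform f g"
    by (simp add: has_fourier_transform_iff L2_iff)
  then show ?thesis unfolding fourier_def by (rule someI[of "has_fourier_transform f"])
qed

lemma integrable_if_bounded_support:
  fixes u :: "'a::euclidean_space \<Rightarrow> complex"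
  assumes [measurable]: "u \<in> borel_measurable borel"
    and b: "\<And>x. cmod (u x) \<le> B" and supp: "\<And>x. norm x > M \<Longrightarrow> u x = 0"
  shows "integrable lborel u" and "energy u < \<infinity>"
proof -
  have "B \<ge> 0" using b norm_ge_zero order_trans by blast
  have "energy u \<le> (\<integral>\<^sup>+x. ennreal (B\<^sup>2) * indicator (cball 0 M :: 'a set) x \<partial>lborel)"
    using supp b \<open>B \<ge> 0\<close> by (intro nn_integral_mono) (auto split: split_indicator intro!: ennreal_leI power_mono)
  also have "\<dots> < \<infinity>"
    using emeasure_lborel_cball_finite[of "0::'a" M]
    by (subst nn_integral_cmult_indicator) (auto simp: ennreal_mult_less_top)
  finally show e: "energy u < \<infinity>" .
  show "integrable lborel u"
    by (rule integrable_if_energy_finite[where B = "cball 0 M"]) (use e supp in auto)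
qed

text \<open>
  The transform of the Gaussian regularisation \<open>u s\<close> of \<open>g\<close> is the convolution of \<open>G\<close> with a Gaussian; it
  converges to \<open>G\<close> pointwise, and to the transform of \<open>g\<close> in \<open>L\<^sup>2\<close> by Bessel's inequality.
\<close>
lemma fourier_inversion:
  fixes G :: "'a::euclidean_space \<Rightarrow> complex"
  assumes cont: "continuous_on UNIV G" and supp: "\<And>\<xi>. norm \<xi> > M \<Longrightarrow> G \<xi> = 0"
  defines "g \<equiv> \<lambda>x. (LINT \<xi>|lborel. cis (x \<bullet> \<xi>) * G \<xi>) / (2 * pi) ^ DIM('a)"
  shows "g \<in> L2" and "energy g \<le> energy G" and "AE \<xi> in lborel. fourier g \<xi> = G \<xi>"
proof -
  let ?c = "(2 * pi) ^ DIM('a)"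
  have c1: "?c \<ge> 1" using pi_gt3 by (intro one_le_power) auto
  have Gm[measurable]: "G \<in> borel_measurable borel"
    using cont by (rule borel_measurable_continuous_onI)
  have "compact (G ` cball 0 M)"
    by (intro compact_continuous_image continuous_on_subset[OF cont]) auto
  then obtain B0 where B0: "\<And>x. x \<in> cball 0 M \<Longrightarrow> cmod (G x) \<le> B0"
    by (metis compact_imp_bounded bounded_iff imageI)
  \<comment> \<open>The maximum with 0 covers \<open>M < 0\<close>, where the ball is empty and
    \<open>B0\<close> is arbitrary.\<close>
  then have B: "cmod (G x) \<le> max B0 0" for x
    using supp[of x] B0[of x] by (cases "norm x > M") (auto simp: le_max_iff_disj)
  note G = integrable_if_bounded_support[where M = M, OF Gm B supp]
  have gm[measurable]: "g \<in> borel_measurable borel"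
    unfolding g_def by measurable
  show eg: "energy g \<le> energy G"
  proof -
    have "energy g = (\<integral>\<^sup>+x. ennreal (1 / ?c\<^sup>2) * ennreal ((cmod (LINT \<xi>|lborel. cis (x \<bullet> \<xi>) * G \<xi>))\<^sup>2) \<partial>lborel)"
      by (intro nn_integral_cong, subst ennreal_mult[symmetric])
         (auto simp: g_def norm_divide power_divide norm_power norm_mult)
    also have "\<dots> = ennreal (1 / ?c\<^sup>2) * energy (\<lambda>x. LINT \<xi>|lborel. cis (x \<bullet> \<xi>) * G \<xi>)"
      by (intro nn_integral_cmult) measurable
    also have "\<dots> \<le> ennreal (1 / ?c\<^sup>2) * (ennreal ?c * energy G)"
      by (intro mult_left_mono bessel(2) G) auto
    also have "\<dots> = ennreal (1 / ?c\<^sup>2 * ?c) * energy G"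
      by (subst ennreal_mult) (auto simp: mult.assoc)
    also have "1 / ?c\<^sup>2 * ?c = 1 / ?c" by (simp add: power2_eq_square)
    also have "ennreal (1 / ?c) * energy G \<le> 1 * energy G"
      using c1 by (intro mult_right_mono) (auto simp: ennreal_le_1)
    finally show ?thesis by simp
  qed
  then show gL2: "g \<in> L2" using G(2) by (auto simp: L2_iff)
  define A where "A = (LINT \<xi>|lborel. cmod (G \<xi>))"
  have gb: "cmod (g x) \<le> A" for x
  proof -
    have "cmod (LINT \<xi>|lborel. cis (x \<bullet> \<xi>) * G \<xi>) \<le> A"
      using integral_norm_bound[of lborel "\<lambda>\<xi>. cis (x \<bullet> \<xi>) * G \<xi>"] by (simp add: A_def norm_mult)
    moreover have "cmod (LINT \<xi>|lborel. cis (x \<bullet> \<xi>) * G \<xi>) / ?c \<le> cmod (LINT \<xi>|lborel. cis (x \<bullet> \<xi>) * G \<xi>) / 1"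
      using c1 by (intro divide_left_mono) auto
    ultimately show ?thesis by (simp add: g_def norm_divide norm_power norm_mult)
  qed
  define u where "u = (\<lambda>s x. complex_of_real (exp (- (s * norm x)\<^sup>2 / 2)) * g x)"
  have um[measurable]: "u s \<in> borel_measurable borel" for s
    unfolding u_def by measurable
  have ui: "integrable lborel (u s)" if "s > 0" for s
    unfolding u_def
    by (rule Bochner_Integration.integrable_bound[OF integrable_mult_left[OF gaussian_integrable[OF that], of A]])
       (auto simp: norm_mult abs_mult intro!: AE_I2 mult_left_mono order_trans[OF gb])
  \<comment> \<open>In this form the kernel has fixed width and \<open>s\<close> sits in the
    argument of \<open>G\<close>, so dominated convergence and continuity of \<open>G\<close> give
    the pointwise limit.\<close>
  have FTu: "fourier_integral (u s) \<xi> = (LINT w|lborel. G (\<xi> + s *\<^sub>R w) * complex_of_real (gauss_kernel 1 w))"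
    if s: "s > 0" for s \<xi>
  proof -
    let ?e = "\<lambda>x::'a. complex_of_real (exp (- (s * norm x)\<^sup>2 / 2))"
    have F: "integrable (lborel \<Otimes>\<^sub>M lborel) (\<lambda>(x, \<eta>). G \<eta> / ?c * (?e x * cis (x \<bullet> (\<eta> - \<xi>))))"
    proof (rule lborel_pair.Fubini_integrable)
      show "integrable lborel (\<lambda>x. LINT \<eta>|lborel. norm (case (x, \<eta>) of (x, \<eta>) \<Rightarrow> G \<eta> / ?c * (?e x * cis (x \<bullet> (\<eta> - \<xi>)))))"
        using gaussian_integrable[OF s, where 'a = 'a] by (simp add: norm_mult norm_divide)
      show "AE x in lborel. integrable lborel (\<lambda>\<eta>. case (x, \<eta>) of (x, \<eta>) \<Rightarrow> G \<eta> / ?c * (?e x * cis (x \<bullet> (\<eta> - \<xi>))))"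
      proof (intro AE_I2)
        fix x :: 'a
        have "integrable lborel (\<lambda>\<eta>. cis (x \<bullet> (\<eta> - \<xi>)) * (G \<eta> * (?e x / ?c)))"
          by (intro integrable_cis_mult integrable_mult_left G) auto
        then show "integrable lborel (\<lambda>\<eta>. case (x, \<eta>) of (x, \<eta>) \<Rightarrow> G \<eta> / ?c * (?e x * cis (x \<bullet> (\<eta> - \<xi>))))"
          by (simp add: mult_ac)
      qed
    qed measurable
    have "fourier_integral (u s) \<xi> = (LINT x|lborel. LINT \<eta>|lborel. G \<eta> / ?c * (?e x * cis (x \<bullet> (\<eta> - \<xi>))))"
      unfolding fourier_integral_def
    proof (intro Bochner_Integration.integral_cong refl)
      fix x :: 'a
      have "cis (- (x \<bullet> \<xi>)) * u s x = (LINT \<eta>|lborel. (cis (- (x \<bullet> \<xi>)) * ?e x / ?c) * (cis (x \<bullet> \<eta>) * G \<eta>))"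
        unfolding u_def g_def integral_mult_right_zero by simp
      also have "\<dots> = (LINT \<eta>|lborel. G \<eta> / ?c * (?e x * cis (x \<bullet> (\<eta> - \<xi>))))"
      proof (intro Bochner_Integration.integral_cong refl)
        fix \<eta> :: 'a
        have "cis (x \<bullet> (\<eta> - \<xi>)) = cis (- (x \<bullet> \<xi>)) * cis (x \<bullet> \<eta>)"
          by (simp add: cis_mult inner_diff_right)
        then show "(cis (- (x \<bullet> \<xi>)) * ?e x / ?c) * (cis (x \<bullet> \<eta>) * G \<eta>) = G \<eta> / ?c * (?e x * cis (x \<bullet> (\<eta> - \<xi>)))"
          by simp
      qed
      finally show "cis (- (x \<bullet> \<xi>)) * u s x = (LINT \<eta>|lborel. G \<eta> / ?c * (?e x * cis (x \<bullet> (\<eta> - \<xi>))))" .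
    qed
    also have "\<dots> = (LINT \<eta>|lborel. LINT x|lborel. G \<eta> / ?c * (?e x * cis (x \<bullet> (\<eta> - \<xi>))))"
      by (rule lborel_pair.Fubini_integral[symmetric, OF F])
    also have "\<dots> = (LINT \<eta>|lborel. G \<eta> * complex_of_real (gauss_kernel s (\<eta> - \<xi>)))"
      unfolding integral_mult_right_zero fourier_gaussian(2)[OF s] by simp
    also have "\<dots> = s ^ DIM('a) *\<^sub>R (LINT w|lborel. G (\<xi> + s *\<^sub>R w) * complex_of_real (gauss_kernel s (\<xi> + s *\<^sub>R w - \<xi>)))"
      by (rule integral_lborel_scale[OF s]) measurable
    also have "\<dots> = (LINT w|lborel. s ^ DIM('a) *\<^sub>R (G (\<xi> + s *\<^sub>R w) * complex_of_real (gauss_kernel s (\<xi> + s *\<^sub>R w - \<xi>))))"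
      by simp
    also have "\<dots> = (LINT w|lborel. G (\<xi> + s *\<^sub>R w) * complex_of_real (gauss_kernel 1 w))"
      by (intro Bochner_Integration.integral_cong refl)
         (simp add: gauss_kernel_scale[OF s, symmetric] scaleR_conv_of_real)
    finally show ?thesis .
  qed
  define s where "s = (\<lambda>n. 1 / real (Suc n))"
  have s0: "s n > 0" for n by (simp add: s_def)
  have slim: "s \<longlonglongrightarrow> 0" unfolding s_def by (intro LIMSEQ_Suc lim_1_over_n)
  have lim: "(\<lambda>n. fourier_integral (u (s n)) \<xi>) \<longlonglongrightarrow> G \<xi>" for \<xi>
  proof -
    have "(\<lambda>n. LINT w|lborel. G (\<xi> + s n *\<^sub>R w) * complex_of_real (gauss_kernel 1 w))
        \<longlonglongrightarrow> (LINT w|lborel. G \<xi> * complex_of_real (gauss_kernel 1 (w::'a)))"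
    proof (rule integral_dominated_convergence[where w = "\<lambda>w. max B0 0 * gauss_kernel 1 w"])
      show "integrable lborel (\<lambda>w::'a. max B0 0 * gauss_kernel 1 w)"
        by (intro integrable_mult_right gauss_kernel_integrable) auto
      show "AE w in lborel. (\<lambda>n. G (\<xi> + s n *\<^sub>R w) * complex_of_real (gauss_kernel 1 w)) \<longlonglongrightarrow> G \<xi> * complex_of_real (gauss_kernel 1 w)"
      proof (intro AE_I2 tendsto_mult tendsto_const)
        fix w
        have "(\<lambda>n. \<xi> + s n *\<^sub>R w) \<longlonglongrightarrow> \<xi> + 0 *\<^sub>R w" by (intro tendsto_intros slim)
        then show "(\<lambda>n. G (\<xi> + s n *\<^sub>R w)) \<longlonglongrightarrow> G \<xi>"
          using cont by (intro continuous_on_tendsto_compose[OF cont]) auto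
      qed
      show "AE w in lborel. norm (G (\<xi> + s n *\<^sub>R w) * complex_of_real (gauss_kernel 1 w)) \<le> max B0 0 * gauss_kernel 1 w" for n
        by (intro AE_I2) (auto simp: norm_mult gauss_kernel_nonneg intro!: mult_right_mono B)
    qed measurable
    then show ?thesis
      by (simp add: FTu[OF s0] gauss_kernel_integrable)
  qed
  define H where "H = fourier g"
  have HF: "has_fourier_transform g H"
    unfolding H_def by (rule has_fourier_transform_exists[OF gL2])
  then have Hm[measurable]: "H \<in> borel_measurable borel" by (simp add: has_fourier_transform_iff L2_iff)
  \<comment> \<open>\<open>H\<close> is defined through sharp truncations, not through Gaussian
    regularisations. Both are compared with \<open>g\<close> by Bessel's inequality, and the
    truncation radius is then sent to infinity.\<close>
  have Hu: "energy (\<lambda>\<xi>. H \<xi> - fourier_integral (u (s n)) \<xi>) \<le> 4 * (ennreal ?c * energy (\<lambda>x. g x - u (s n) x))" for n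
  proof -
    let ?E = "\<lambda>r. energy (\<lambda>\<xi>. H \<xi> - fourier_integral (truncate r g) \<xi>)"
    let ?R = "\<lambda>r. energy (\<lambda>x. g x - truncate r g x)"
    let ?X = "energy (\<lambda>x. g x - u (s n) x)"
    have "energy (\<lambda>\<xi>. H \<xi> - fourier_integral (u (s n)) \<xi>) \<le> 2 * ?E r + 2 * (ennreal ?c * (2 * ?R r + 2 * ?X))" for r
    proof -
      have "energy (\<lambda>\<xi>. fourier_integral (truncate r g) \<xi> - fourier_integral (u (s n)) \<xi>)
          \<le> ennreal ?c * energy (\<lambda>x. truncate r g x - u (s n) x)"
        by (intro bessel_diff truncate_integrable gL2 ui s0)
      also have "\<dots> \<le> ennreal ?c * (2 * energy (\<lambda>x. truncate r g x - g x) + 2 * ?X)"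
        by (intro mult_left_mono energy_triangle) auto
      finally have "energy (\<lambda>\<xi>. fourier_integral (truncate r g) \<xi> - fourier_integral (u (s n)) \<xi>)
          \<le> ennreal ?c * (2 * ?R r + 2 * ?X)" by (simp only: energy_minus_commute[of "truncate r g" g])
      then show ?thesis
        by (intro order_trans[OF energy_triangle[where g = "fourier_integral (truncate r g)"] add_left_mono];
            measurable?) (auto intro: mult_left_mono)
    qed
    moreover have "((\<lambda>r. 2 * ?E r + 2 * (ennreal ?c * (2 * ?R r + 2 * ?X))) \<longlongrightarrow> 2 * 0 + 2 * (ennreal ?c * (2 * 0 + 2 * ?X))) at_top"
      using HF by (intro tendsto_add ennreal_tendsto_cmult tendsto_const energy_truncate_tendsto gL2)
        (auto simp: has_fourier_transform_iff ennreal_mult_less_top)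
    ultimately have "energy (\<lambda>\<xi>. H \<xi> - fourier_integral (u (s n)) \<xi>) \<le> 2 * 0 + 2 * (ennreal ?c * (2 * 0 + 2 * ?X))"
      by (intro tendsto_lowerbound[where F = at_top and f = "\<lambda>r. 2 * ?E r + 2 * (ennreal ?c * (2 * ?R r + 2 * ?X))"]) auto
    also have "\<dots> = 2 * (2 * (ennreal ?c * ?X))" by (simp add: mult_ac)
    also have "\<dots> = 4 * (ennreal ?c * ?X)" by (simp add: mult.assoc[symmetric])
    finally show ?thesis .
  qed
  have ulim: "(\<lambda>n. energy (\<lambda>x. g x - u (s n) x)) \<longlonglongrightarrow> 0"
  proof -
    have "(\<lambda>n. energy (\<lambda>x. g x - u (s n) x)) \<longlonglongrightarrow> (\<integral>\<^sup>+x. 0 \<partial>(lborel :: 'a measure))"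
    proof (rule nn_integral_dominated_convergence[where w = "\<lambda>x. ennreal ((cmod (g x))\<^sup>2)"])
      have d: "g x - u r x = complex_of_real (1 - exp (- (r * norm x)\<^sup>2 / 2)) * g x" for r x
        by (simp add: u_def algebra_simps)
      show "AE x in lborel. (\<lambda>n. ennreal ((cmod (g x - u (s n) x))\<^sup>2)) \<longlonglongrightarrow> 0"
      proof (intro AE_I2)
        fix x :: 'a
        have "(\<lambda>n. (cmod (complex_of_real (1 - exp (- (s n * norm x)\<^sup>2 / 2)) * g x))\<^sup>2) \<longlonglongrightarrow>
          (cmod (complex_of_real (1 - exp (- (0 * norm x)\<^sup>2 / 2)) * g x))\<^sup>2"
          by (intro tendsto_intros slim) auto
        then show "(\<lambda>n. ennreal ((cmod (g x - u (s n) x))\<^sup>2)) \<longlonglongrightarrow> 0"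
          unfolding d by (subst ennreal_0[symmetric], intro tendsto_ennrealI) simp
      qed
      have "cmod (g x - u r x) \<le> cmod (g x)" for r x
        unfolding d norm_mult norm_of_real by (intro mult_left_le_one_le) auto
      then show "AE x in lborel. ennreal ((cmod (g x - u (s n) x))\<^sup>2) \<le> ennreal ((cmod (g x))\<^sup>2)" for n
        by (intro AE_I2 ennreal_leI power_mono) auto
    qed (use gL2 in \<open>auto simp: L2_iff\<close>)
    then show ?thesis by simp
  qed
  \<comment> \<open>The same functions converge to \<open>G\<close> pointwise and to
    \<open>H\<close> in the mean, so Fatou's lemma identifies the two limits.\<close>
  have "energy (\<lambda>\<xi>. H \<xi> - G \<xi>) = (\<integral>\<^sup>+\<xi>. liminf (\<lambda>n. ennreal ((cmod (H \<xi> - fourier_integral (u (s n)) \<xi>))\<^sup>2)) \<partial>lborel)"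
    by (intro nn_integral_cong lim_imp_Liminf[symmetric] tendsto_ennrealI tendsto_intros lim) auto
  also have "\<dots> \<le> liminf (\<lambda>n. energy (\<lambda>\<xi>. H \<xi> - fourier_integral (u (s n)) \<xi>))"
    by (intro nn_integral_liminf) measurable
  also have "\<dots> \<le> liminf (\<lambda>n. 4 * (ennreal ?c * energy (\<lambda>x. g x - u (s n) x)))"
    by (intro Liminf_mono always_eventually allI Hu)
  also have "\<dots> = 4 * (ennreal ?c * 0)"
    by (intro lim_imp_Liminf ennreal_tendsto_cmult ulim) auto
  finally have "energy (\<lambda>\<xi>. H \<xi> - G \<xi>) = 0" by simp
  then have "AE \<xi> in lborel. ennreal ((cmod (H \<xi> - G \<xi>))\<^sup>2) = 0"
    by (subst (asm) nn_integral_0_iff_AE) auto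
  then show "AE \<xi> in lborel. fourier g \<xi> = G \<xi>"
    unfolding H_def by eventually_elim simp
qed

section \<open>Local smoothing\<close>

text \<open>The union defining \<open>ess_supp\<close> may be uncountable; by Lindelof's theorem a
  countable subfamily covers it, and countably many null sets are null.\<close>

lemma AE_zero_off_ess_supp: "AE \<xi> in lborel. \<xi> \<notin> ess_supp g \<longrightarrow> g \<xi> = 0"
proof -
  let ?F = "{U. open U \<and> (AE \<xi> in lborel. \<xi> \<in> U \<longrightarrow> g \<xi> = 0)}"
  obtain F where F: "F \<subseteq> ?F" "countable F" "\<Union>F = \<Union>?F"
    by (rule Lindelof[of ?F]) auto
  then have "AE \<xi> in lborel. \<forall>U\<in>F. \<xi> \<in> U \<longrightarrow> g \<xi> = 0"
    by (subst AE_ball_countable) auto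
  then show ?thesis
  proof eventually_elim
    case (elim \<xi>)
    then show ?case using F(3) unfolding ess_supp_def by blast
  qed
qed

lemma ess_supp_subset:
  assumes "closed A" "AE \<xi> in lborel. \<xi> \<notin> A \<longrightarrow> g \<xi> = 0"
  shows "ess_supp g \<subseteq> A"
proof -
  have "- A \<in> {U. open U \<and> (AE \<xi> in lborel. \<xi> \<in> U \<longrightarrow> g \<xi> = 0)}"
    using assms by (auto simp: open_Compl)
  then show ?thesis unfolding ess_supp_def by blast
qed

text \<open>
  The mass of a thin neighbourhood of a level set of \<open>norm \<eta> powr \<alpha>\<close> inside a small ball is computed by averaging
  over the dilations \<open>\<eta> \<mapsto> l powr (1/\<alpha>) *\<^sub>R \<eta>\<close>, \<open>1 \<le> l \<le> 1 + r\<close>: for fixed \<open>\<eta>\<close> these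
  cross the level set transversally.
\<close>
lemma radial_schur_bound:
  fixes \<xi> :: "real^2"
  assumes \<alpha>: "\<alpha> > 1" and r: "0 < r" "r \<le> 1/8" and \<xi>: "3/8 \<le> norm \<xi>" "norm \<xi> \<le> 17/8" and s: "s > 0"
  shows "(\<integral>\<^sup>+\<eta>. ennreal (gauss_kernel s (v - norm \<eta> powr \<alpha>)) * indicator (ball \<xi> r) \<eta> \<partial>lborel)
    \<le> ennreal (64 * 8 powr \<alpha> * pi * r)" (is "?I \<le> _")
proof -
  \<comment> \<open>Contains every \<open>\<eta>\<close> that some dilation in use carries into
    \<open>ball \<xi> r\<close>. The factor 4 covers \<open>r + 9/4 * r\<close>. Removing the small
    ball is allowed because the dilated point has norm at least 1/4 and the dilation factor is at
    most 2.\<close>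
  define S where "S = cball \<xi> (4 * r) - ball 0 (1/8)"
  have S[measurable]: "S \<in> sets borel" unfolding S_def by simp
  have dil: "?I \<le> (\<integral>\<^sup>+\<eta>. 4 * (ennreal (gauss_kernel s (v - l * norm \<eta> powr \<alpha>)) * indicator S \<eta>) \<partial>lborel)"
    if l: "l \<in> {1..1 + r}" for l
  proof -
    \<comment> \<open>With this exponent the phase depends linearly on the averaging parameter
      \<open>l\<close>.\<close>
    define c where "c = l powr (1/\<alpha>)"
    have c1: "1 \<le> c" using l \<alpha> by (simp add: c_def ge_one_powr_ge_zero)
    have "c \<le> l powr 1" unfolding c_def using l \<alpha> by (intro powr_mono) auto
    then have cl: "c \<le> 1 + r" using l by simp
    have ca: "c powr \<alpha> = l" using l \<alpha> by (simp add: c_def powr_powr)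
    have "?I = ennreal (c ^ 2) * (\<integral>\<^sup>+\<eta>. ennreal (gauss_kernel s (v - norm (0 + c *\<^sub>R \<eta>) powr \<alpha>)) * indicator (ball \<xi> r) (0 + c *\<^sub>R \<eta>) \<partial>lborel)"
    proof -
      have "(\<lambda>\<eta>. ennreal (gauss_kernel s (v - norm \<eta> powr \<alpha>)) * indicator (ball \<xi> r) \<eta>) \<in> borel_measurable borel"
        by (rule borel_measurable_times_ennreal[OF _ borel_measurable_indicator]) simp_all
      then show ?thesis using c1 nn_integral_lborel_scale[of c "\<lambda>\<eta>. ennreal (gauss_kernel s (v - norm \<eta> powr \<alpha>)) * indicator (ball \<xi> r) \<eta>" 0]
        by simp
    qed
    also have "\<dots> \<le> ennreal 4 * (\<integral>\<^sup>+\<eta>. ennreal (gauss_kernel s (v - l * norm \<eta> powr \<alpha>)) * indicator S \<eta> \<partial>lborel)"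
    proof (rule mult_mono)
      have "c\<^sup>2 \<le> 2\<^sup>2" using c1 cl r by (intro power_mono) auto
      then show "ennreal (c\<^sup>2) \<le> ennreal 4" by (intro ennreal_leI) simp
      show "(\<integral>\<^sup>+\<eta>. ennreal (gauss_kernel s (v - norm (0 + c *\<^sub>R \<eta>) powr \<alpha>)) * indicator (ball \<xi> r) (0 + c *\<^sub>R \<eta>) \<partial>lborel)
          \<le> (\<integral>\<^sup>+\<eta>. ennreal (gauss_kernel s (v - l * norm \<eta> powr \<alpha>)) * indicator S \<eta> \<partial>lborel)"
      proof (rule nn_integral_mono)
        fix \<eta> :: "real^2"
        have "c *\<^sub>R \<eta> \<in> ball \<xi> r \<Longrightarrow> \<eta> \<in> S"
        proof -
          assume "c *\<^sub>R \<eta> \<in> ball \<xi> r"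
          then have d: "norm (\<xi> - c *\<^sub>R \<eta>) < r" by (simp add: dist_norm)
          have n: "norm (c *\<^sub>R \<eta>) = c * norm \<eta>" using c1 by simp
          have u: "c * norm \<eta> \<le> 9/4"
            using norm_triangle_ineq2[of "c *\<^sub>R \<eta>" \<xi>] d \<xi> r unfolding n norm_minus_commute[of "c *\<^sub>R \<eta>"] by linarith
          have lo: "1/4 \<le> c * norm \<eta>"
            using norm_triangle_ineq2[of \<xi> "c *\<^sub>R \<eta>"] d \<xi> r unfolding n by linarith
          have "1 * norm \<eta> \<le> c * norm \<eta>" using c1 by (intro mult_right_mono) auto
          then have u': "norm \<eta> \<le> 9/4" using u by simp
          have "c * norm \<eta> \<le> 2 * norm \<eta>" using cl r by (intro mult_right_mono) auto
          then have lo': "1/8 \<le> norm \<eta>" using lo by simp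
          have "norm (\<xi> - \<eta>) \<le> norm (\<xi> - c *\<^sub>R \<eta>) + norm (c *\<^sub>R \<eta> - \<eta>)"
            using norm_triangle_ineq[of "\<xi> - c *\<^sub>R \<eta>" "c *\<^sub>R \<eta> - \<eta>"] by simp
          also have "c *\<^sub>R \<eta> - \<eta> = (c - 1) *\<^sub>R \<eta>" by (simp add: algebra_simps)
          also have "norm ((c - 1) *\<^sub>R \<eta>) = (c - 1) * norm \<eta>" using c1 by simp
          also have "(c - 1) * norm \<eta> \<le> r * (9/4)" using cl c1 u' r by (intro mult_mono) auto
          finally have "norm (\<xi> - \<eta>) \<le> 4 * r" using d r by simp
          then show "\<eta> \<in> S" using lo' by (simp add: S_def dist_norm)
        qed
        moreover have "norm (c *\<^sub>R \<eta>) powr \<alpha> = l * norm \<eta> powr \<alpha>"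
          using c1 by (simp add: powr_mult ca)
        ultimately show "ennreal (gauss_kernel s (v - norm (0 + c *\<^sub>R \<eta>) powr \<alpha>)) * indicator (ball \<xi> r) (0 + c *\<^sub>R \<eta>)
            \<le> ennreal (gauss_kernel s (v - l * norm \<eta> powr \<alpha>)) * indicator S \<eta>"
          unfolding add_0 by (auto split: split_indicator)
      qed
    qed auto
    also have "\<dots> = (\<integral>\<^sup>+\<eta>. 4 * (ennreal (gauss_kernel s (v - l * norm \<eta> powr \<alpha>)) * indicator S \<eta>) \<partial>lborel)"
      by (subst nn_integral_cmult) auto
    finally show ?thesis .
  qed
  \<comment> \<open>The substitution \<open>x = \<rho> * l\<close> reduces the integral to the mass
    1 of the kernel, at the price \<open>1 / \<rho> \<le> 8 powr \<alpha>\<close>. This is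
    transversality: \<open>\<rho>\<close> is the derivative of the phase in
    \<open>l\<close>.\<close>
  have inner: "(\<integral>\<^sup>+l. ennreal (gauss_kernel s (v - l * norm \<eta> powr \<alpha>)) \<partial>lborel) \<le> ennreal (8 powr \<alpha>)"
    if "\<eta> \<in> S" for \<eta>
  proof -
    define \<rho> where "\<rho> = norm \<eta> powr \<alpha>"
    have "norm \<eta> \<ge> 1/8" using that by (auto simp: S_def)
    then have "(1/8) powr \<alpha> \<le> \<rho>" unfolding \<rho>_def using \<alpha> by (intro powr_mono2) auto
    then have \<rho>1: "1 \<le> 8 powr \<alpha> * \<rho>"
      by (simp add: powr_divide field_simps)
    then have \<rho>: "\<rho> > 0" by (metis \<rho>_def mult_zero_right not_one_le_zero powr_ge_zero order_le_less)
    have "1 = (\<integral>\<^sup>+x. ennreal (gauss_kernel s (v - x)) \<partial>(lborel :: real measure))"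
      using nn_integral_gauss_kernel[OF s, where 'a = real]
      by (subst nn_integral_lborel_shift(2)[of "\<lambda>x. ennreal (gauss_kernel s x)"]) auto
    also have "\<dots> = ennreal (\<rho> ^ DIM(real)) * (\<integral>\<^sup>+l. ennreal (gauss_kernel s (v - (0 + \<rho> *\<^sub>R l))) \<partial>lborel)"
      by (rule nn_integral_lborel_scale[OF \<rho>]) measurable
    finally have one: "ennreal \<rho> * (\<integral>\<^sup>+l. ennreal (gauss_kernel s (v - l * \<rho>)) \<partial>lborel) = 1"
      by (simp add: mult.commute)
    have "(\<integral>\<^sup>+l. ennreal (gauss_kernel s (v - l * \<rho>)) \<partial>lborel)
        \<le> ennreal (8 powr \<alpha> * \<rho>) * (\<integral>\<^sup>+l. ennreal (gauss_kernel s (v - l * \<rho>)) \<partial>lborel)"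
      using mult_right_mono[of 1 "ennreal (8 powr \<alpha> * \<rho>)" "\<integral>\<^sup>+l. ennreal (gauss_kernel s (v - l * \<rho>)) \<partial>lborel"] \<rho>1
      by simp
    also have "\<dots> = ennreal (8 powr \<alpha>) * (ennreal \<rho> * (\<integral>\<^sup>+l. ennreal (gauss_kernel s (v - l * \<rho>)) \<partial>lborel))"
      using \<rho> by (subst ennreal_mult) (auto simp: mult.assoc)
    finally show ?thesis unfolding one by (simp add: \<rho>_def)
  qed
  \<comment> \<open>The averaging interval has length \<open>r\<close>. The right side is of the
    order of the area \<open>r\<^sup>2\<close>, so division leaves one power of \<open>r\<close>,
    uniformly in \<open>s\<close>.\<close>
  have "ennreal r * ?I = (\<integral>\<^sup>+l. ?I * indicator {1..1 + r} l \<partial>lborel)"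
    using r by (subst nn_integral_cmult_indicator) (auto simp: mult.commute)
  also have "\<dots> \<le> (\<integral>\<^sup>+l. \<integral>\<^sup>+\<eta>. 4 * (ennreal (gauss_kernel s (v - l * norm \<eta> powr \<alpha>)) * indicator S \<eta>) \<partial>lborel \<partial>lborel)"
    by (intro nn_integral_mono) (use dil in \<open>auto split: split_indicator\<close>)
  also have "\<dots> = (\<integral>\<^sup>+\<eta>. \<integral>\<^sup>+l. 4 * (ennreal (gauss_kernel s (v - l * norm \<eta> powr \<alpha>)) * indicator S \<eta>) \<partial>lborel \<partial>lborel)"
    by (rule lborel_pair.Fubini') measurable
  also have "\<dots> = (\<integral>\<^sup>+\<eta>. 4 * ((\<integral>\<^sup>+l. ennreal (gauss_kernel s (v - l * norm \<eta> powr \<alpha>)) \<partial>lborel) * indicator S \<eta>) \<partial>lborel)"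
    by (intro nn_integral_cong) (simp add: nn_integral_cmult nn_integral_multc)
  also have "\<dots> \<le> (\<integral>\<^sup>+\<eta>. (4 * ennreal (8 powr \<alpha>)) * indicator (cball \<xi> (4 * r)) \<eta> \<partial>lborel)"
  proof (intro nn_integral_mono)
    fix \<eta>
    show "4 * ((\<integral>\<^sup>+l. ennreal (gauss_kernel s (v - l * norm \<eta> powr \<alpha>)) \<partial>lborel) * indicator S \<eta>)
        \<le> (4 * ennreal (8 powr \<alpha>)) * indicator (cball \<xi> (4 * r)) \<eta>"
    proof (cases "\<eta> \<in> S")
      case True
      then have "\<eta> \<in> cball \<xi> (4 * r)" by (simp add: S_def)
      then show ?thesis using inner[OF True] True by (simp add: mult_left_mono)
    qed simp
  qed
  also have "\<dots> = 4 * ennreal (8 powr \<alpha>) * ennreal (pi * (4 * r)\<^sup>2)"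
    using r by (subst nn_integral_cmult_indicator) (auto simp: emeasure_cball unit_ball_vol_2)
  also have "\<dots> = ennreal r * ennreal (64 * 8 powr \<alpha> * pi * r)"
    using r by (simp add: ennreal_mult[symmetric] ennreal_numeral[symmetric] power2_eq_square mult_ac del: ennreal_numeral)
  finally show ?thesis
    using r by (subst (asm) ennreal_mult_le_mult_iff) auto
qed

section \<open>Frequency-localized data and their energy over all times\<close>

definition localized :: "real \<Rightarrow> (real^2 \<Rightarrow> real^2 \<Rightarrow> real) \<Rightarrow> (real^2 \<Rightarrow> complex) \<Rightarrow> real \<Rightarrow> real^2 \<Rightarrow> complex" where
  "localized \<alpha> b h s \<xi> = (LINT \<eta>|lborel. (complex_of_real (b \<xi> \<eta>) * h \<eta>) * cis (s * norm \<eta> powr \<alpha>))"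

text \<open>The kernel is abstract so that the bump and the commutator are two instances. Its bound
  is required only where \<open>h\<close> does not vanish, since the commutator estimate uses that
  \<open>\<eta>\<close> lies in the annulus. Continuity of \<open>b\<close> is assumed because it
  makes \<open>localized\<close> continuous, as Fourier inversion needs.\<close>

locale localization =
  fixes \<alpha> r \<beta> :: real and b :: "real^2 \<Rightarrow> real^2 \<Rightarrow> real" and h :: "real^2 \<Rightarrow> complex"
  assumes \<alpha>: "\<alpha> > 1" and r: "0 < r" "r \<le> 1/8"
    and b_cont: "continuous_on UNIV (\<lambda>p. b (fst p) (snd p))"
    and h_meas[measurable]: "h \<in> borel_measurable borel" and h_energy: "energy h < \<infinity>"
    and h_supp: "\<And>\<eta>. h \<eta> \<noteq> 0 \<Longrightarrow> 1/2 \<le> norm \<eta> \<and> norm \<eta> \<le> 2"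
    and b_bound: "\<And>\<xi> \<eta>. h \<eta> \<noteq> 0 \<Longrightarrow> \<bar>b \<xi> \<eta>\<bar> \<le> \<beta> * indicator (ball \<xi> r) \<eta>"
    and \<beta>: "\<beta> \<ge> 0"
begin

lemma b_meas: "(\<lambda>p. b (fst p) (snd p)) \<in> borel_measurable (borel \<Otimes>\<^sub>M borel)"
  using borel_measurable_continuous_onI[OF b_cont] by (simp add: borel_prod)

lemma b_meas'[measurable (raw)]:
  assumes "f \<in> borel_measurable M" "g \<in> borel_measurable M"
  shows "(\<lambda>x. b (f x) (g x)) \<in> borel_measurable M"
  using measurable_compose[OF measurable_Pair[OF assms] b_meas] by simp

lemma h_integrable: "integrable lborel h"
  by (rule integrable_if_energy_finite[where B = "cball 0 2"]) (use h_energy h_supp in auto)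

lemma bh_bound: "cmod (complex_of_real (b \<xi> \<eta>) * h \<eta>) \<le> \<beta> * cmod (h \<eta>) * indicator (ball \<xi> r) \<eta>"
  using mult_right_mono[OF b_bound[of \<eta> \<xi>], of "cmod (h \<eta>)"]
  by (cases "h \<eta> = 0") (auto simp: norm_mult mult_ac)

lemma bh_bound': "cmod (complex_of_real (b \<xi> \<eta>) * h \<eta>) \<le> \<beta> * cmod (h \<eta>)"
  by (rule order_trans[OF bh_bound]) (use \<beta> in \<open>auto split: split_indicator\<close>)

lemma bh_integrable: "integrable lborel (\<lambda>\<eta>. complex_of_real (b \<xi> \<eta>) * h \<eta>)"
  by (rule Bochner_Integration.integrable_bound[OF integrable_mult_right[OF integrable_norm[OF h_integrable], of \<beta>]])
     (auto intro!: AE_I2 order_trans[OF bh_bound'])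

lemma bhc_integrable: "integrable lborel (\<lambda>\<eta>. (complex_of_real (b \<xi> \<eta>) * h \<eta>) * cis (s * norm \<eta> powr \<alpha>))"
  using integrable_cis_mult[OF bh_integrable, of "\<lambda>\<eta>. s * norm \<eta> powr \<alpha>"] by (simp add: mult.commute)

lemma localized_bound: "cmod (localized \<alpha> b h s \<xi>) \<le> \<beta> * (LINT \<eta>|lborel. cmod (h \<eta>))"
proof -
  have "cmod (localized \<alpha> b h s \<xi>) \<le> (LINT \<eta>|lborel. cmod ((complex_of_real (b \<xi> \<eta>) * h \<eta>) * cis (s * norm \<eta> powr \<alpha>)))"
    unfolding localized_def by (rule integral_norm_bound)
  also have "\<dots> \<le> (LINT \<eta>|lborel. \<beta> * cmod (h \<eta>))"
    using bh_bound' by (intro integral_mono integrable_mult_right integrable_norm h_integrable bhc_integrable)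
      (auto simp: norm_mult)
  finally show ?thesis by simp
qed

text \<open>Here the larger annulus of the hypothesis arises: a shift by less than 1/8 moves norms
  from \<open>[1/2, 2]\<close> to \<open>[3/8, 17/8]\<close>.\<close>

lemma bh_eq_0:
  assumes "norm \<xi> < 3/8 \<or> norm \<xi> > 17/8"
  shows "complex_of_real (b \<xi> \<eta>) * h \<eta> = 0"
proof (cases "h \<eta> = 0 \<or> \<eta> \<notin> ball \<xi> r")
  case True
  then show ?thesis using bh_bound[of \<xi> \<eta>] by auto
next
  case False
  then have "norm (\<xi> - \<eta>) < 1/8" "1/2 \<le> norm \<eta>" "norm \<eta> \<le> 2"
    using h_supp[of \<eta>] r by (auto simp: dist_norm)
  then show ?thesis
    using assms norm_triangle_ineq2[of \<xi> \<eta>] norm_triangle_ineq2[of \<eta> \<xi>]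
    by (auto simp: norm_minus_commute)
qed

lemma localized_eq_0: "norm \<xi> < 3/8 \<or> norm \<xi> > 17/8 \<Longrightarrow> localized \<alpha> b h s \<xi> = 0"
  unfolding localized_def by (simp add: bh_eq_0 del: mult_eq_0_iff)

lemma localized_meas: "(\<lambda>p. localized \<alpha> b h (fst p) (snd p)) \<in> borel_measurable (borel \<Otimes>\<^sub>M borel)"
  unfolding localized_def by measurable

lemma localized_meas'[measurable (raw)]:
  assumes "f \<in> borel_measurable M" "g \<in> borel_measurable M"
  shows "(\<lambda>x. localized \<alpha> b h (f x) (g x)) \<in> borel_measurable M"
  using measurable_compose[OF measurable_Pair[OF assms] localized_meas] by simp

text \<open>Needed because \<open>fourier_inversion\<close> is proved for continuous functions of
  bounded support.\<close>

lemma localized_continuous: "continuous_on UNIV (localized \<alpha> b h s)"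
proof (rule continuous_on_sequentiallyI)
  fix u :: "nat \<Rightarrow> real^2" and a :: "real^2" assume u: "u \<longlonglongrightarrow> a"
  show "(\<lambda>n. localized \<alpha> b h s (u n)) \<longlonglongrightarrow> localized \<alpha> b h s a"
    unfolding localized_def
  proof (rule integral_dominated_convergence[where w = "\<lambda>\<eta>. \<beta> * cmod (h \<eta>)"])
    show "AE \<eta> in lborel. (\<lambda>n. (complex_of_real (b (u n) \<eta>) * h \<eta>) * cis (s * norm \<eta> powr \<alpha>))
        \<longlonglongrightarrow> (complex_of_real (b a \<eta>) * h \<eta>) * cis (s * norm \<eta> powr \<alpha>)"
    proof (intro AE_I2 tendsto_intros)
      fix \<eta> :: "real^2"
      have "(\<lambda>n. (u n, \<eta>)) \<longlonglongrightarrow> (a, \<eta>)" by (intro tendsto_intros u)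
      from continuous_on_tendsto_compose[OF b_cont this]
      show "(\<lambda>n. b (u n) \<eta>) \<longlonglongrightarrow> b a \<eta>" by simp
    qed
    show "AE \<eta> in lborel. norm ((complex_of_real (b (u n) \<eta>) * h \<eta>) * cis (s * norm \<eta> powr \<alpha>)) \<le> \<beta> * cmod (h \<eta>)" for n
      using bh_bound' by (intro AE_I2) (simp add: norm_mult)
    show "integrable lborel (\<lambda>\<eta>. \<beta> * cmod (h \<eta>))"
      by (intro integrable_mult_right integrable_norm h_integrable)
  qed measurable
qed

text \<open>For fixed \<open>\<xi>\<close> this is \<open>schur_oscillatory\<close> in the
  one-dimensional time variable with phase \<open>norm \<eta> powr \<alpha>\<close>, which
  contributes \<open>r\<close> by \<open>radial_schur_bound\<close>. Integration in
  \<open>\<xi>\<close> contributes the area \<open>pi * r\<^sup>2\<close>.\<close>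

lemma localized_energy:
  "(\<integral>\<^sup>+s. energy (localized \<alpha> b h s) \<partial>lborel) \<le> ennreal (128 * 8 powr \<alpha> * pi ^ 3 * \<beta>\<^sup>2 * r ^ 3) * energy h"
proof -
  let ?C = "2 * pi * (64 * 8 powr \<alpha> * pi * r)"
  have slice: "(\<integral>\<^sup>+s. ennreal ((cmod (localized \<alpha> b h s \<xi>))\<^sup>2) \<partial>lborel)
      \<le> ennreal (?C * \<beta>\<^sup>2) * (\<integral>\<^sup>+\<eta>. ennreal ((cmod (h \<eta>))\<^sup>2) * indicator (ball \<eta> r) \<xi> \<partial>lborel)" for \<xi>
  \<comment> \<open>The level set bound needs \<open>\<xi>\<close> in the larger annulus; elsewhere
    the left side vanishes.\<close>
  proof (cases "norm \<xi> < 3/8 \<or> norm \<xi> > 17/8")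
    case True
    then show ?thesis by (simp add: localized_eq_0)
  next
    case False
    have "(\<integral>\<^sup>+s. ennreal ((cmod (LINT \<eta>|lborel. (complex_of_real (b \<xi> \<eta>) * h \<eta>) * cis (s \<bullet> (norm \<eta> powr \<alpha>))))\<^sup>2) \<partial>lborel)
      \<le> ennreal ((2 * pi) ^ DIM(real) * (64 * 8 powr \<alpha> * pi * r)) * energy (\<lambda>\<eta>. complex_of_real (b \<xi> \<eta>) * h \<eta>)"
    proof (rule schur_oscillatory[where S = "ball \<xi> r"])
      show "complex_of_real (b \<xi> \<eta>) * h \<eta> = 0" if "\<eta> \<notin> ball \<xi> r" for \<eta>
        using bh_bound[of \<xi> \<eta>] that by auto
      show "(\<integral>\<^sup>+\<eta>'. ennreal (gauss_kernel s (norm \<eta> powr \<alpha> - norm \<eta>' powr \<alpha>)) * indicator (ball \<xi> r) \<eta>' \<partial>lborel)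
        \<le> ennreal (64 * 8 powr \<alpha> * pi * r)" if "s > 0" for s \<eta>
        using False by (intro radial_schur_bound \<alpha> r that) auto
    qed (use bh_integrable in auto)
    also have "energy (\<lambda>\<eta>. complex_of_real (b \<xi> \<eta>) * h \<eta>) \<le> (\<integral>\<^sup>+\<eta>. ennreal (\<beta>\<^sup>2) * (ennreal ((cmod (h \<eta>))\<^sup>2) * indicator (ball \<eta> r) \<xi>) \<partial>lborel)"
    proof (intro nn_integral_mono)
      fix \<eta>
      have "(cmod (complex_of_real (b \<xi> \<eta>) * h \<eta>))\<^sup>2 \<le> (\<beta> * cmod (h \<eta>) * indicator (ball \<xi> r) \<eta>)\<^sup>2"
        by (intro power_mono bh_bound) auto
      also have "\<dots> = \<beta>\<^sup>2 * (cmod (h \<eta>))\<^sup>2 * indicator (ball \<eta> r) \<xi>"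
        by (auto simp: power_mult_distrib dist_commute split: split_indicator)
      finally have "ennreal ((cmod (complex_of_real (b \<xi> \<eta>) * h \<eta>))\<^sup>2) \<le> ennreal (\<beta>\<^sup>2 * (cmod (h \<eta>))\<^sup>2 * indicator (ball \<eta> r) \<xi>)"
        by (rule ennreal_leI)
      then show "ennreal ((cmod (complex_of_real (b \<xi> \<eta>) * h \<eta>))\<^sup>2) \<le> ennreal (\<beta>\<^sup>2) * (ennreal ((cmod (h \<eta>))\<^sup>2) * indicator (ball \<eta> r) \<xi>)"
        by (auto simp: ennreal_mult split: split_indicator)
    qed
    also have "\<dots> = ennreal (\<beta>\<^sup>2) * (\<integral>\<^sup>+\<eta>. ennreal ((cmod (h \<eta>))\<^sup>2) * indicator (ball \<eta> r) \<xi> \<partial>lborel)"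
      by (intro nn_integral_cmult) (auto simp: mem_ball indicator_def)
    finally show ?thesis
      using r by (simp add: localized_def ennreal_mult mult.assoc mult_left_mono)
  qed
  have "(\<integral>\<^sup>+s. energy (localized \<alpha> b h s) \<partial>lborel) = (\<integral>\<^sup>+\<xi>. \<integral>\<^sup>+s. ennreal ((cmod (localized \<alpha> b h s \<xi>))\<^sup>2) \<partial>lborel \<partial>lborel)"
    by (rule lborel_pair.Fubini') measurable
  also have "\<dots> \<le> (\<integral>\<^sup>+\<xi>. ennreal (?C * \<beta>\<^sup>2) * (\<integral>\<^sup>+\<eta>. ennreal ((cmod (h \<eta>))\<^sup>2) * indicator (ball \<eta> r) \<xi> \<partial>lborel) \<partial>lborel)"
    by (intro nn_integral_mono slice)
  also have "\<dots> = ennreal (?C * \<beta>\<^sup>2) * (\<integral>\<^sup>+\<xi>. \<integral>\<^sup>+\<eta>. ennreal ((cmod (h \<eta>))\<^sup>2) * indicator (ball \<eta> r) \<xi> \<partial>lborel \<partial>lborel)"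
    by (intro nn_integral_cmult) (auto simp: mem_ball indicator_def)
  also have "(\<integral>\<^sup>+\<xi>. \<integral>\<^sup>+\<eta>. ennreal ((cmod (h \<eta>))\<^sup>2) * indicator (ball \<eta> r) \<xi> \<partial>lborel \<partial>lborel)
     = (\<integral>\<^sup>+\<eta>. \<integral>\<^sup>+\<xi>. ennreal ((cmod (h \<eta>))\<^sup>2) * indicator (ball \<eta> r) \<xi> \<partial>lborel \<partial>lborel)"
    by (rule lborel_pair.Fubini') (auto simp: mem_ball indicator_def)
  also have "\<dots> = (\<integral>\<^sup>+\<eta>. ennreal ((cmod (h \<eta>))\<^sup>2) * ennreal (pi * r\<^sup>2) \<partial>lborel)"
    using r by (intro nn_integral_cong, subst nn_integral_cmult_indicator) (auto simp: emeasure_ball unit_ball_vol_2)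
  also have "\<dots> = ennreal (pi * r\<^sup>2) * energy h"
    by (subst nn_integral_multc) (auto simp: mult.commute)
  also have "ennreal (?C * \<beta>\<^sup>2) * (ennreal (pi * r\<^sup>2) * energy h) = ennreal (?C * \<beta>\<^sup>2 * (pi * r\<^sup>2)) * energy h"
    using r by (subst ennreal_mult) (auto simp: mult.assoc)
  also have "?C * \<beta>\<^sup>2 * (pi * r\<^sup>2) = 128 * 8 powr \<alpha> * pi ^ 3 * \<beta>\<^sup>2 * r ^ 3"
    by (simp add: power2_eq_square power3_eq_cube)
  finally show ?thesis .
qed

end

section \<open>Maximal functions\<close>

lemma ennreal_add_power2_le: "(a + b)\<^sup>2 \<le> 4 * a\<^sup>2 + 4 * (b::ennreal)\<^sup>2"
proof -
  have "(a + b)\<^sup>2 \<le> (2 * max a b)\<^sup>2"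
    by (intro power_mono) (auto simp: mult_2 intro!: add_mono)
  also have "\<dots> = 4 * (max a b)\<^sup>2" by (simp add: power_mult_distrib)
  also have "\<dots> \<le> 4 * a\<^sup>2 + 4 * b\<^sup>2" by (auto simp: max_def)
  finally show ?thesis .
qed

lemma ennreal_SUP_power2_le:
  fixes f :: "'i \<Rightarrow> ennreal"
  assumes "\<And>i. i \<in> I \<Longrightarrow> (f i)\<^sup>2 \<le> Y"
  shows "(SUP i\<in>I. f i)\<^sup>2 \<le> Y"
proof -
  \<comment> \<open>A double supremum avoids a continuity argument for squaring; each mixed product
    is at most the larger of two squares.\<close>
  have "(SUP i\<in>I. f i)\<^sup>2 = (SUP i\<in>I. SUP j\<in>I. f j * f i)"
    by (simp add: power2_eq_square SUP_mult_left_ennreal SUP_mult_right_ennreal)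
  also have "\<dots> \<le> Y"
  proof (intro SUP_least)
    fix i j assume ij: "i \<in> I" "j \<in> I"
    have "f j * f i \<le> (max (f i) (f j))\<^sup>2"
      unfolding power2_eq_square by (intro mult_mono) auto
    also have "\<dots> \<le> Y" using assms ij by (auto simp: max_def)
    finally show "f j * f i \<le> Y" .
  qed
  finally show ?thesis .
qed

text \<open>Makes the maximal functions measurable: by continuity in time a countable supremum
  suffices.\<close>

lemma SUP_Rats_eq:
  fixes f :: "real \<Rightarrow> ennreal"
  assumes "continuous_on UNIV f" "open I"
  shows "(SUP u\<in>I. f u) = (SUP u\<in>I \<inter> \<rat>. f u)"
proof (rule antisym)
  show "(SUP u\<in>I. f u) \<le> (SUP u\<in>I \<inter> \<rat>. f u)"
  proof (rule SUP_least)
    let ?c = "SUP u\<in>I \<inter> \<rat>. f u"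
    fix u assume "u \<in> I"
    have "closed {u. f u \<le> ?c}"
      using assms(1) by (intro closed_Collect_le) auto
    moreover have "I \<inter> \<rat> \<subseteq> {u. f u \<le> ?c}" by (auto intro: SUP_upper)
    ultimately have "closure (I \<inter> \<rat>) \<subseteq> {u. f u \<le> ?c}" by (rule closure_minimal[rotated])
    moreover have "I \<subseteq> closure (I \<inter> \<rat>)"
      using open_Int_closure_subset[OF assms(2), of \<rat>] by (simp add: Rats_closure_real)
    ultimately show "f u \<le> ?c" using \<open>u \<in> I\<close> by auto
  qed
qed (rule SUP_subset_mono, auto)

text \<open>\<open>T\<close> expressed by frequency data. \<open>fourier\<close> is determined only
  up to null sets, whereas \<open>G\<close> can be chosen with exact support and continuity.\<close>

definition propagate :: "real \<Rightarrow> (real^2 \<Rightarrow> complex) \<Rightarrow> real^2 \<Rightarrow> real \<Rightarrow> complex" where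
  "propagate \<alpha> G x u = (LINT \<xi>|lborel. cis (x \<bullet> \<xi> + u * norm \<xi> powr \<alpha>) * G \<xi>)"

lemma T_eq_propagate:
  assumes "AE \<xi> in lborel. fourier f \<xi> = G \<xi>" "f \<in> L2" "G \<in> borel_measurable borel"
  shows "T \<alpha> f x u = propagate \<alpha> G x u"
proof -
  have [measurable]: "fourier f \<in> borel_measurable borel"
    using has_fourier_transform_exists[OF assms(2)] by (simp add: has_fourier_transform_iff L2_iff)
  have [measurable]: "G \<in> borel_measurable borel" by fact
  show ?thesis
    unfolding T_def propagate_def
    by (rule integral_cong_AE, measurable) (use assms(1) in \<open>auto elim: eventually_mono\<close>)
qed

lemma propagate_continuous:
  assumes G: "integrable lborel G"
  shows "continuous_on UNIV (propagate \<alpha> G x)"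
proof (rule continuous_on_sequentiallyI)
  fix u :: "nat \<Rightarrow> real" and a assume u: "u \<longlonglongrightarrow> a"
  have [measurable]: "G \<in> borel_measurable borel"
    using borel_measurable_integrable[OF G] by simp
  show "(\<lambda>n. propagate \<alpha> G x (u n)) \<longlonglongrightarrow> propagate \<alpha> G x a"
    unfolding propagate_def
  proof (rule integral_dominated_convergence[where w = "\<lambda>\<xi>. cmod (G \<xi>)"])
    show "AE \<xi> in lborel. (\<lambda>n. cis (x \<bullet> \<xi> + u n * norm \<xi> powr \<alpha>) * G \<xi>) \<longlonglongrightarrow> cis (x \<bullet> \<xi> + a * norm \<xi> powr \<alpha>) * G \<xi>"
      by (intro AE_I2 tendsto_intros u)
  qed (use G in \<open>auto simp: norm_mult\<close>)
qed

section \<open>Maximal functions of the localized data\<close>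

context localization
begin

lemma localized_integrable: "integrable lborel (localized \<alpha> b h s)"
proof (rule integrable_if_bounded_support(1)[OF _ localized_bound])
  show "localized \<alpha> b h s \<xi> = 0" if "17/8 < norm \<xi>" for \<xi>
    using that by (simp add: localized_eq_0)
qed measurable

definition M :: "real \<Rightarrow> real \<Rightarrow> real^2 \<Rightarrow> ennreal" where
  "M R s x = (SUP u\<in>{0<..<R}. ennreal (cmod (propagate \<alpha> (localized \<alpha> b h s) x u)))"

lemma M_meas: "(\<lambda>p. M R (fst p) (snd p)) \<in> borel_measurable (borel \<Otimes>\<^sub>M borel)"
proof -
  have "M R s x = (SUP u\<in>{0<..<R} \<inter> \<rat>. ennreal (cmod (propagate \<alpha> (localized \<alpha> b h s) x u)))" for s x
    unfolding M_def
    by (intro SUP_Rats_eq continuous_on_ennreal continuous_intros propagate_continuous localized_integrable)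
  then have "(\<lambda>p. M R (fst p) (snd p)) =
      (\<lambda>p. SUP u\<in>{0<..<R} \<inter> \<rat>. ennreal (cmod (LINT \<xi>|lborel. cis (snd p \<bullet> \<xi> + u * norm \<xi> powr \<alpha>) * localized \<alpha> b h (fst p) \<xi>)))"
    by (simp add: propagate_def)
  also have "\<dots> \<in> borel_measurable (borel \<Otimes>\<^sub>M borel)"
    by (intro borel_measurable_SUP countable_Int2 countable_rat) measurable
  finally show ?thesis .
qed

lemma M_meas'[measurable (raw)]:
  assumes "f \<in> borel_measurable N" "g \<in> borel_measurable N"
  shows "(\<lambda>x. M R (f x) (g x)) \<in> borel_measurable N"
  using measurable_compose[OF measurable_Pair[OF assms] M_meas] by simp

text \<open>\<open>localized\<close> is continuous and supported in the larger annulus, so it is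
  almost everywhere the transform of some \<open>g\<close> in \<open>L2\<close> of no larger energy,
  and the hypothesis applies to \<open>g\<close>.\<close>

lemma M_energy:
  assumes hyp: "\<And>f. f \<in> L2 \<Longrightarrow> ess_supp (fourier f) \<subseteq> {\<xi>. 3/8 \<le> norm \<xi> \<and> norm \<xi> \<le> 17/8} \<Longrightarrow>
    (\<integral>\<^sup>+x. (maximal_T \<alpha> f R x)\<^sup>2 * indicator (ball 0 R) x \<partial>lborel) \<le> c * energy f"
  shows "(\<integral>\<^sup>+x. (M R s x)\<^sup>2 * indicator (ball 0 R) x \<partial>lborel) \<le> c * energy (localized \<alpha> b h s)"
proof -
  define G where "G = localized \<alpha> b h s"
  define g where "g = (\<lambda>x. (LINT \<xi>|lborel. cis (x \<bullet> \<xi>) * G \<xi>) / (2 * pi) ^ DIM(real^2))"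
  have Gm: "G \<in> borel_measurable borel" unfolding G_def by measurable
  have G0: "G \<xi> = 0" if "17/8 < norm \<xi>" for \<xi>
    using that by (simp add: G_def localized_eq_0)
  have inv: "g \<in> L2" "energy g \<le> energy G" "AE \<xi> in lborel. fourier g \<xi> = G \<xi>"
    unfolding g_def
    using fourier_inversion[of G "17/8", OF localized_continuous[of s, folded G_def] G0] by auto
  have "ess_supp (fourier g) \<subseteq> {\<xi>. 3/8 \<le> norm \<xi> \<and> norm \<xi> \<le> 17/8}"
  proof (rule ess_supp_subset)
    show "closed {\<xi>::real^2. 3/8 \<le> norm \<xi> \<and> norm \<xi> \<le> 17/8}"
      by (intro closed_Collect_conj closed_Collect_le continuous_intros)
    show "AE \<xi> in lborel. \<xi> \<notin> {\<xi>. 3/8 \<le> norm \<xi> \<and> norm \<xi> \<le> 17/8} \<longrightarrow> fourier g \<xi> = 0"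
      using inv(3) by eventually_elim (auto simp: G_def intro!: localized_eq_0)
  qed
  then have "(\<integral>\<^sup>+x. (maximal_T \<alpha> g R x)\<^sup>2 * indicator (ball 0 R) x \<partial>lborel) \<le> c * energy g"
    by (intro hyp inv(1)) auto
  also have "\<dots> \<le> c * energy G" by (intro mult_left_mono inv(2)) auto
  also have "maximal_T \<alpha> g R = M R s"
    by (simp add: fun_eq_iff maximal_T_def M_def T_eq_propagate[OF inv(3) inv(1) Gm] G_def)
  finally show ?thesis by (simp add: G_def)
qed

end

section \<open>Duhamel's formula for a single pair of frequencies\<close>

lemma phase_identity:
  fixes a b t R :: real
  assumes "R > 0"
  shows "(LINT s|lborel. indicator {t - R..t} s *\<^sub>R
      (cis ((t - s) * b) * (complex_of_real (1 / R) + \<i> * complex_of_real ((s - t + R) / R * (a - b))) * cis (s * a)))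
    = cis (t * a)"
proof -
  \<comment> \<open>The antiderivative: a linear cutoff times the phase that evolves with
    \<open>a\<close> up to time \<open>s\<close> and with \<open>b\<close> afterwards. It is 0 at
    \<open>s = t - R\<close> and \<open>cis (t * a)\<close> at \<open>s = t\<close>.\<close>
  let ?F = "\<lambda>s. complex_of_real ((s - t + R) / R) * cis (s * a + (t - s) * b)"
  let ?f = "\<lambda>s. cis ((t - s) * b) * (complex_of_real (1 / R) + \<i> * complex_of_real ((s - t + R) / R * (a - b))) * cis (s * a)"
  have "(LINT s|lborel. indicator {t - R..t} s *\<^sub>R ?f s) = ?F t - ?F (t - R)"
  proof (rule integral_FTC_Icc)
    show "t - R \<le> t" using assms by simp
    show "(?F has_vector_derivative ?f s) (at s within {t - R..t})" for s
    proof -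
      have "((\<lambda>s. cis (s * a + (t - s) * b)) has_vector_derivative (a - b) *\<^sub>R (\<i> * cis (s * a + (t - s) * b))) (at s within {t - R..t})"
      proof -
        have "((\<lambda>s. s * a + (t - s) * b) has_vector_derivative (a - b)) (at s within {t - R..t})"
          unfolding has_real_derivative_iff_has_vector_derivative[symmetric]
          by (auto intro!: derivative_eq_intros)
        moreover have "(cis has_vector_derivative (\<i> * cis y)) (at y within X)" for y X
          using has_vector_derivative_iexp[of y X] by (simp add: cis_conv_exp[abs_def])
        ultimately show ?thesis
          using vector_diff_chain_within by (fastforce simp: o_def)
      qed
      then have "(?F has_vector_derivative
          complex_of_real ((s - t + R) / R) * ((a - b) *\<^sub>R (\<i> * cis (s * a + (t - s) * b))) + complex_of_real (1 / R) * cis (s * a + (t - s) * b)) (at s within {t - R..t})"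
        using assms by (intro has_vector_derivative_mult has_vector_derivative_of_real) (auto intro!: derivative_eq_intros)
      also have "cis (s * a + (t - s) * b) = cis ((t - s) * b) * cis (s * a)"
        by (simp add: cis_mult add.commute)
      also have "complex_of_real ((s - t + R) / R) * ((a - b) *\<^sub>R (\<i> * (cis ((t - s) * b) * cis (s * a)))) + complex_of_real (1 / R) * (cis ((t - s) * b) * cis (s * a)) = ?f s"
        unfolding scaleR_conv_of_real of_real_mult by (simp only: distrib_left distrib_right mult_ac add_ac)
      finally show ?thesis .
    qed
    show "continuous_on {t - R..t} ?f" using assms by (intro continuous_intros) auto
  qed
  then show ?thesis using assms by simp
qed

text \<open>Mean value theorem. The bound 3 leaves room for the norms up to 17/8 that occur, and
  \<open>3 powr \<alpha>\<close> crudely replaces \<open>3 powr (\<alpha> - 1)\<close>.\<close>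

lemma powr_lipschitz:
  fixes a b :: real
  assumes "\<alpha> > 1" "0 < a" "a \<le> 3" "0 < b" "b \<le> 3"
  shows "\<bar>a powr \<alpha> - b powr \<alpha>\<bar> \<le> \<alpha> * 3 powr \<alpha> * \<bar>a - b\<bar>"
proof -
  have "\<bar>y powr \<alpha> - x powr \<alpha>\<bar> \<le> \<alpha> * 3 powr \<alpha> * \<bar>y - x\<bar>" if "0 < x" "x < y" "y \<le> 3" for x y
  proof -
    have "\<exists>z. x < z \<and> z < y \<and> y powr \<alpha> - x powr \<alpha> = (y - x) * (\<alpha> * z powr (\<alpha> - 1))"
      using that by (intro MVT2) (auto intro!: derivative_eq_intros)
    then obtain z where z: "x < z" "z < y" "y powr \<alpha> - x powr \<alpha> = (y - x) * (\<alpha> * z powr (\<alpha> - 1))"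
      by blast
    have "z powr (\<alpha> - 1) \<le> 3 powr (\<alpha> - 1)" using z that assms(1) by (intro powr_mono2) auto
    also have "\<dots> \<le> 3 powr \<alpha>" by (intro powr_mono) auto
    finally have "(y - x) * (\<alpha> * z powr (\<alpha> - 1)) \<le> (y - x) * (\<alpha> * 3 powr \<alpha>)"
      using that assms(1) by (intro mult_left_mono) auto
    moreover have "0 \<le> (y - x) * (\<alpha> * z powr (\<alpha> - 1))" using that assms(1) by simp
    ultimately show ?thesis using z(3) that by (simp add: mult_ac)
  qed
  from this[of a b] this[of b a] show ?thesis
    using assms by (cases a b rule: linorder_cases) (auto simp: abs_minus_commute)
qed

text \<open>The bump of the overview. Continuity serves Fourier inversion and nonnegativity the
  lower bound of its transform. No decay of that transform is used, so smoothness is not asked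
  for.\<close>

definition tent :: "real \<Rightarrow> real^2 \<Rightarrow> real" where
  "tent r z = max 0 (1 - norm z / r)"

lemma tent_continuous[continuous_intros]:
  assumes "continuous_on S f"
  shows "continuous_on S (\<lambda>x. tent r (f x))"
proof -
  have "continuous_on S (\<lambda>x. max 0 (1 - norm (f x) * inverse r))"
    by (intro continuous_intros assms)
  then show ?thesis by (simp add: tent_def divide_inverse)
qed

lemma tent_nonneg: "tent r z \<ge> 0" and tent_le_1: "r > 0 \<Longrightarrow> tent r z \<le> 1"
  and tent_eq_0: "r > 0 \<Longrightarrow> norm z \<ge> r \<Longrightarrow> tent r z = 0"
  by (auto simp: tent_def)

lemma tent_measurable[measurable]: "tent r \<in> borel_measurable borel"
  by (intro borel_measurable_continuous_onI tent_continuous continuous_on_id)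

lemma tent_integrable:
  assumes "r > 0"
  shows "integrable lborel (tent r)"
proof (rule Bochner_Integration.integrable_bound)
  show "integrable lborel (indicator (cball (0::real^2) r) :: _ \<Rightarrow> real)"
    using emeasure_lborel_cball_finite[of "0::real^2" r] by (intro integrable_real_indicator) auto
  show "AE z in lborel. norm (tent r z) \<le> norm (indicator (cball 0 r) z :: real)"
    using assms by (intro AE_I2) (auto simp: tent_nonneg tent_le_1 tent_eq_0 split: split_indicator)
qed auto

lemma tent_integral_ge:
  assumes r: "r > 0"
  shows "(LINT z|lborel. tent r z) \<ge> pi * r\<^sup>2 / 8"
proof -
  have "pi * r\<^sup>2 / 8 = (LINT z|lborel. (1/2) * indicator (ball (0::real^2) (r/2)) z)"
    using r by (simp add: content_ball unit_ball_vol_2 power_divide)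
  also have "\<dots> \<le> (LINT z|lborel. tent r z)"
  proof (intro integral_mono integrable_mult_right tent_integrable r)
    show "integrable lborel (indicator (ball (0::real^2) (r/2)) :: _ \<Rightarrow> real)"
      using emeasure_lborel_ball_finite[of "0::real^2" "r/2"] by (intro integrable_real_indicator) auto
    show "1/2 * indicator (ball 0 (r/2)) z \<le> tent r z" for z
      using r by (auto simp: tent_def field_simps split: split_indicator)
  qed
  finally show ?thesis .
qed

text \<open>On the support \<open>\<bar>x \<bullet> z\<bar> \<le> 1 \<le> pi / 3\<close>, so the
  cosine is at least 1/2 and the real part keeps half of the integral.\<close>

lemma tent_fourier_ge:
  fixes x :: "real^2"
  assumes r: "r > 0" and x: "norm x * r \<le> 1"
  shows "cmod (LINT z|lborel. cis (x \<bullet> z) * complex_of_real (tent r z)) \<ge> pi * r\<^sup>2 / 16"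
proof -
  have i: "integrable lborel (\<lambda>z. cis (x \<bullet> z) * complex_of_real (tent r z))"
    by (intro integrable_cis_mult integrable_of_real tent_integrable r) measurable
  have "pi * r\<^sup>2 / 16 \<le> (LINT z|lborel. 1/2 * tent r z)"
    using tent_integral_ge[OF r] by simp
  also have "\<dots> \<le> (LINT z|lborel. Re (cis (x \<bullet> z) * complex_of_real (tent r z)))"
  proof (intro integral_mono integrable_mult_right tent_integrable r integrable_Re i)
    fix z :: "real^2"
    show "1/2 * tent r z \<le> Re (cis (x \<bullet> z) * complex_of_real (tent r z))"
    proof (cases "norm z \<ge> r")
      case True
      then show ?thesis using r by (simp add: tent_eq_0)
    next
      case False
      have "\<bar>x \<bullet> z\<bar> \<le> norm x * norm z" by (rule Cauchy_Schwarz_ineq2)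
      also have "\<dots> \<le> norm x * r" using False by (intro mult_left_mono) auto
      finally have "\<bar>x \<bullet> z\<bar> \<le> pi / 3" using x pi_gt3 by simp
      then have "cos (pi / 3) \<le> cos \<bar>x \<bullet> z\<bar>" by (intro cos_monotone_0_pi_le) auto
      then have "1/2 \<le> cos (x \<bullet> z)" by (simp add: cos_60)
      then show ?thesis using mult_right_mono[OF _ tent_nonneg[of r z], of "1/2" "cos (x \<bullet> z)"] by simp
    qed
  qed
  also have "\<dots> = Re (LINT z|lborel. cis (x \<bullet> z) * complex_of_real (tent r z))"
    by (rule integral_Re[OF i])
  also have "\<dots> \<le> cmod (LINT z|lborel. cis (x \<bullet> z) * complex_of_real (tent r z))"
    by (rule complex_Re_le_cmod)
  finally show ?thesis .
qed

section \<open>Localization to time windows of length \<open>R\<close>\<close>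

locale time_localization =
  fixes \<alpha> R :: real and h :: "real^2 \<Rightarrow> complex"
  assumes \<alpha>: "\<alpha> > 1" and R: "R \<ge> 1"
    and h_meas[measurable]: "h \<in> borel_measurable borel" and h_energy: "energy h < \<infinity>"
    and h_supp: "\<And>\<eta>. h \<eta> \<noteq> 0 \<Longrightarrow> 1/2 \<le> norm \<eta> \<and> norm \<eta> \<le> 2"
begin

text \<open>The 8 does two things: for \<open>R \<ge> 1\<close> it keeps \<open>r \<le> 1/8\<close>,
  so frequencies stay in the larger annulus, and \<open>R * r = 1/8\<close> keeps the weight bounded
  below on \<open>ball 0 R\<close>.\<close>

definition "r = 1 / (8 * R)"
definition "L = \<alpha> * 3 powr \<alpha>"
text \<open>The factor \<open>1 / R\<close> of the first kernel in the overview is not part of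
  \<open>b1\<close>; it is carried separately in \<open>duhamel\<close>.\<close>

definition b1 :: "real^2 \<Rightarrow> real^2 \<Rightarrow> real" where "b1 \<xi> \<eta> = tent r (\<xi> - \<eta>)"
definition b2 :: "real^2 \<Rightarrow> real^2 \<Rightarrow> real" where
  "b2 \<xi> \<eta> = tent r (\<xi> - \<eta>) * (norm \<eta> powr \<alpha> - norm \<xi> powr \<alpha>)"

lemma r: "0 < r" "r \<le> 1/8"
  using R by (auto simp: r_def field_simps)

sublocale b1: localization \<alpha> r 1 b1 h
proof
  show "continuous_on UNIV (\<lambda>p. b1 (fst p) (snd p))"
    unfolding b1_def by (intro continuous_intros)
  show "\<bar>b1 \<xi> \<eta>\<bar> \<le> 1 * indicator (ball \<xi> r) \<eta>" for \<xi> \<eta>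
    using r by (auto simp: b1_def tent_nonneg tent_le_1 tent_eq_0 dist_norm split: split_indicator)
qed (use \<alpha> r h_energy h_supp in auto)

text \<open>On the support of the bump the phases differ by at most \<open>L * r\<close>. This gain
  of \<open>r\<close>, of order \<open>1 / R\<close>, makes the commutator as small as the cutoff
  term.\<close>

sublocale b2: localization \<alpha> r "L * r" b2 h
proof
  show "continuous_on UNIV (\<lambda>p. b2 (fst p) (snd p))"
    unfolding b2_def using \<alpha> by (intro continuous_intros continuous_on_powr') auto
  show "0 \<le> L * r" using \<alpha> r by (simp add: L_def)
  show "\<bar>b2 \<xi> \<eta>\<bar> \<le> L * r * indicator (ball \<xi> r) \<eta>" if "h \<eta> \<noteq> 0" for \<xi> \<eta>
  proof (cases "\<eta> \<in> ball \<xi> r")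
    case False
    then show ?thesis using r by (simp add: b2_def tent_eq_0 dist_norm)
  next
    case True
    then have d: "norm (\<xi> - \<eta>) < r" by (simp add: dist_norm)
    then have d': "\<bar>norm \<eta> - norm \<xi>\<bar> \<le> r"
      using norm_triangle_ineq3[of \<eta> \<xi>] by (simp add: norm_minus_commute)
    then have "\<bar>norm \<eta> powr \<alpha> - norm \<xi> powr \<alpha>\<bar> \<le> \<alpha> * 3 powr \<alpha> * \<bar>norm \<eta> - norm \<xi>\<bar>"
      using h_supp[OF that] r by (intro powr_lipschitz \<alpha>) auto
    also have "\<dots> \<le> L * r" unfolding L_def using d' \<alpha> by (intro mult_left_mono) auto
    finally have "tent r (\<xi> - \<eta>) * \<bar>norm \<eta> powr \<alpha> - norm \<xi> powr \<alpha>\<bar> \<le> 1 * (L * r)"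
      using r by (intro mult_mono) (auto simp: tent_nonneg tent_le_1)
    then show ?thesis using True by (simp add: b2_def abs_mult tent_nonneg)
  qed
qed (use \<alpha> r h_energy h_supp in auto)

abbreviation "V1 \<equiv> localized \<alpha> b1 h"
abbreviation "V2 \<equiv> localized \<alpha> b2 h"

lemma window_integrable: "integrable lborel (indicator {t - R..t} :: real \<Rightarrow> real)"
  by (intro integrable_real_indicator) (auto simp: emeasure_lborel_Icc_eq)

text \<open>
  Duhamel's formula with the cutoff \<open>(s - t + R) / R\<close>, which vanishes at \<open>s = t - R\<close>, so that there
  is no initial term.
\<close>
lemma duhamel:
  "V1 t \<xi> = (LINT s|lborel. indicator {t - R..t} s *\<^sub>R (cis ((t - s) * norm \<xi> powr \<alpha>) *
     (complex_of_real (1 / R) * V1 s \<xi> + \<i> * complex_of_real ((s - t + R) / R) * V2 s \<xi>)))"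
proof -
  \<comment> \<open>The integrand of \<open>phase_identity\<close> with
    \<open>b = norm \<xi> powr \<alpha>\<close> and \<open>a\<close> to be set to
    \<open>norm \<eta> powr \<alpha>\<close>.\<close>
  define w where "w = (\<lambda>s a. cis ((t - s) * norm \<xi> powr \<alpha>) *
     (complex_of_real (1 / R) + \<i> * complex_of_real ((s - t + R) / R * (a - norm \<xi> powr \<alpha>))) * cis (s * a))"
  have wm[measurable]: "(\<lambda>p. w (fst p) (snd p)) \<in> borel_measurable (borel \<Otimes>\<^sub>M borel)"
    unfolding w_def by measurable
  let ?K = "\<lambda>s \<eta>. (complex_of_real (b1 \<xi> \<eta>) * h \<eta>) * (indicator {t - R..t} s *\<^sub>R w s (norm \<eta> powr \<alpha>))"
  have K: "integrable (lborel \<Otimes>\<^sub>M lborel) (\<lambda>(s, \<eta>). ?K s \<eta>)"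
  proof (rule Bochner_Integration.integrable_bound[OF pair_mult_integrable[OF window_integrable
        integrable_mult_right[OF integrable_norm[OF b1.h_integrable], of "1 / R + L * r"]]])
    show "(\<lambda>(s, \<eta>). ?K s \<eta>) \<in> borel_measurable (lborel \<Otimes>\<^sub>M lborel)"
      unfolding w_def by measurable
    have "norm (?K s \<eta>) \<le> norm (indicator {t - R..t} s * ((1 / R + L * r) * norm (h \<eta>)))" for s \<eta>
    proof (cases "s \<in> {t - R..t} \<and> h \<eta> \<noteq> 0")
      case True
      have le1: "\<bar>(s - t + R) / R\<bar> \<le> 1" using True R by (auto simp: abs_le_iff field_simps)
      let ?d = "norm \<eta> powr \<alpha> - norm \<xi> powr \<alpha>"
      have "cmod (complex_of_real (1 / R) + \<i> * complex_of_real ((s - t + R) / R * ?d)) \<le> 1 / R + \<bar>(s - t + R) / R\<bar> * \<bar>?d\<bar>"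
        using R by (intro order_trans[OF norm_triangle_ineq]) (simp only: norm_mult norm_of_real norm_ii abs_mult mult_1_left abs_divide; simp)
      also have "\<dots> \<le> 1 / R + 1 * \<bar>?d\<bar>"
        using le1 by (intro add_left_mono mult_right_mono) auto
      \<comment> \<open>The bump must stay attached to the phase difference: only their product
        \<open>b2\<close> is bounded by \<open>L * r\<close>.\<close>
      finally have "b1 \<xi> \<eta> * cmod (w s (norm \<eta> powr \<alpha>)) \<le> b1 \<xi> \<eta> * (1 / R + \<bar>?d\<bar>)"
        by (intro mult_left_mono) (auto simp: w_def norm_mult b1_def tent_nonneg)
      also have "\<dots> = b1 \<xi> \<eta> * (1 / R) + \<bar>b2 \<xi> \<eta>\<bar>"
        by (simp add: b1_def b2_def abs_mult tent_nonneg distrib_left)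
      also have "\<dots> \<le> 1 * (1 / R) + L * r"
      proof (intro add_mono mult_right_mono)
        show "b1 \<xi> \<eta> \<le> 1" using r by (simp add: b1_def tent_le_1)
        show "\<bar>b2 \<xi> \<eta>\<bar> \<le> L * r"
          using b2.b_bound[of \<eta> \<xi>] b2.\<beta> True by (auto split: split_indicator_asm)
      qed (use R in auto)
      finally have "b1 \<xi> \<eta> * cmod (w s (norm \<eta> powr \<alpha>)) * cmod (h \<eta>) \<le> (1 / R + L * r) * cmod (h \<eta>)"
        by (intro mult_right_mono) auto
      also have "\<dots> \<le> \<bar>(1 / R + L * r) * cmod (h \<eta>)\<bar>" by (rule abs_ge_self)
      finally show ?thesis using True by (simp add: norm_mult b1_def tent_nonneg mult_ac)
    qed auto
    then show "AE p in lborel \<Otimes>\<^sub>M lborel. norm (case p of (s, \<eta>) \<Rightarrow> ?K s \<eta>) \<le> norm (indicator {t - R..t} (fst p) * ((1 / R + L * r) * norm (h (snd p))))"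
      by (intro AE_I2) (auto simp only: split_beta)
  qed
  have "V1 t \<xi> = (LINT \<eta>|lborel. LINT s|lborel. ?K s \<eta>)"
    unfolding localized_def w_def using R by (simp only: integral_mult_right_zero phase_identity)
  also have "\<dots> = (LINT s|lborel. LINT \<eta>|lborel. ?K s \<eta>)"
    by (rule lborel_pair.Fubini_integral[OF K])
  also have "\<dots> = (LINT s|lborel. indicator {t - R..t} s *\<^sub>R (cis ((t - s) * norm \<xi> powr \<alpha>) *
     (complex_of_real (1 / R) * V1 s \<xi> + \<i> * complex_of_real ((s - t + R) / R) * V2 s \<xi>)))"
  proof (intro Bochner_Integration.integral_cong refl)
    fix s
    let ?e1 = "\<lambda>\<eta>. (complex_of_real (b1 \<xi> \<eta>) * h \<eta>) * cis (s * norm \<eta> powr \<alpha>)"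
    let ?e2 = "\<lambda>\<eta>. (complex_of_real (b2 \<xi> \<eta>) * h \<eta>) * cis (s * norm \<eta> powr \<alpha>)"
    have "complex_of_real (1 / R) * V1 s \<xi> + \<i> * complex_of_real ((s - t + R) / R) * V2 s \<xi>
       = (LINT \<eta>|lborel. complex_of_real (1 / R) * ?e1 \<eta> + \<i> * complex_of_real ((s - t + R) / R) * ?e2 \<eta>)"
      unfolding localized_def integral_mult_right_zero[symmetric]
      by (intro Bochner_Integration.integral_add[symmetric] integrable_mult_right b1.bhc_integrable b2.bhc_integrable)
    then have "indicator {t - R..t} s *\<^sub>R (cis ((t - s) * norm \<xi> powr \<alpha>) *
     (complex_of_real (1 / R) * V1 s \<xi> + \<i> * complex_of_real ((s - t + R) / R) * V2 s \<xi>))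
     = (LINT \<eta>|lborel. indicator {t - R..t} s *\<^sub>R (cis ((t - s) * norm \<xi> powr \<alpha>) *
     (complex_of_real (1 / R) * ?e1 \<eta> + \<i> * complex_of_real ((s - t + R) / R) * ?e2 \<eta>)))"
      by (simp only: integral_mult_right_zero integral_scaleR_right)
    also have "\<dots> = (LINT \<eta>|lborel. ?K s \<eta>)"
      unfolding w_def b1_def b2_def scaleR_conv_of_real of_real_mult
      by (intro Bochner_Integration.integral_cong refl) (simp only: distrib_left distrib_right mult_ac)
    finally show "(LINT \<eta>|lborel. ?K s \<eta>) = indicator {t - R..t} s *\<^sub>R (cis ((t - s) * norm \<xi> powr \<alpha>) *
     (complex_of_real (1 / R) * V1 s \<xi> + \<i> * complex_of_real ((s - t + R) / R) * V2 s \<xi>))" ..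
  qed
  finally show ?thesis .
qed

text \<open>The convolution theorem. \<open>V1 t\<close> already contains the evolution up to time
  \<open>t\<close>, hence the time 0 on the left.\<close>

lemma propagate_V1:
  "propagate \<alpha> (V1 t) x 0 = (LINT z|lborel. cis (x \<bullet> z) * complex_of_real (tent r z)) * propagate \<alpha> h x t"
proof -
  let ?\<psi> = "LINT z|lborel. cis (x \<bullet> z) * complex_of_real (tent r z)"
  let ?K = "\<lambda>\<xi> \<eta>. (h \<eta> * cis (t * norm \<eta> powr \<alpha>)) * (cis (x \<bullet> \<xi>) * complex_of_real (tent r (\<xi> - \<eta>)))"
  have "integrable lborel (indicator (cball (0::real^2) 3) :: _ \<Rightarrow> real)"
    using emeasure_lborel_cball_finite[of "0::real^2" 3] by (intro integrable_real_indicator) auto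
  note dom = pair_mult_integrable[OF this integrable_norm[OF b1.h_integrable]]
  have K: "integrable (lborel \<Otimes>\<^sub>M lborel) (\<lambda>(\<xi>, \<eta>). ?K \<xi> \<eta>)"
  proof (rule Bochner_Integration.integrable_bound[OF dom])
    show "(\<lambda>(\<xi>, \<eta>). ?K \<xi> \<eta>) \<in> borel_measurable (lborel \<Otimes>\<^sub>M lborel)" by measurable
    have "norm (?K \<xi> \<eta>) \<le> norm (indicator (cball (0::real^2) 3) \<xi> * norm (h \<eta>))" for \<xi> \<eta>
    proof (cases "h \<eta> = 0 \<or> norm (\<xi> - \<eta>) \<ge> r")
      case True
      then show ?thesis using r by (auto simp: tent_eq_0)
    next
      case False
      then have "norm \<xi> \<le> 3" using h_supp[of \<eta>] r norm_triangle_ineq2[of \<xi> \<eta>] by auto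
      moreover have "cmod (h \<eta>) * tent r (\<xi> - \<eta>) \<le> cmod (h \<eta>) * 1"
        using r by (intro mult_left_mono tent_le_1) auto
      ultimately show ?thesis by (simp add: norm_mult tent_nonneg)
    qed
    then show "AE p in lborel \<Otimes>\<^sub>M lborel. norm (case p of (\<xi>, \<eta>) \<Rightarrow> ?K \<xi> \<eta>) \<le> norm (indicator (cball (0::real^2) 3) (fst p) * norm (h (snd p)))"
      by (intro AE_I2) (auto simp only: split_beta)
  qed
  have "propagate \<alpha> (V1 t) x 0 = (LINT \<xi>|lborel. LINT \<eta>|lborel. ?K \<xi> \<eta>)"
    unfolding propagate_def localized_def integral_mult_right_zero[symmetric]
    by (intro Bochner_Integration.integral_cong refl) (simp add: b1_def mult_ac)
  also have "\<dots> = (LINT \<eta>|lborel. LINT \<xi>|lborel. ?K \<xi> \<eta>)"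
    by (rule lborel_pair.Fubini_integral[symmetric, OF K])
  also have "\<dots> = (LINT \<eta>|lborel. ?\<psi> * (cis (x \<bullet> \<eta> + t * norm \<eta> powr \<alpha>) * h \<eta>))"
  proof (intro Bochner_Integration.integral_cong refl)
    fix \<eta> :: "real^2"
    have "(LINT \<xi>|lborel. cis (x \<bullet> \<xi>) * complex_of_real (tent r (\<xi> - \<eta>)))
        = (LINT z|lborel. cis (x \<bullet> (\<eta> + z)) * complex_of_real (tent r ((\<eta> + z) - \<eta>)))"
      by (rule integral_lborel_shift[symmetric]) measurable
    also have "\<dots> = (LINT z|lborel. cis (x \<bullet> \<eta>) * (cis (x \<bullet> z) * complex_of_real (tent r z)))"
      by (simp add: inner_add_right cis_mult[symmetric] mult.assoc)
    also have "\<dots> = cis (x \<bullet> \<eta>) * ?\<psi>" by (rule integral_mult_right_zero)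
    finally show "(LINT \<xi>|lborel. ?K \<xi> \<eta>) = ?\<psi> * (cis (x \<bullet> \<eta> + t * norm \<eta> powr \<alpha>) * h \<eta>)"
      unfolding integral_mult_right_zero by (simp add: cis_mult[symmetric])
  qed
  also have "\<dots> = ?\<psi> * propagate \<alpha> h x t"
    unfolding propagate_def by (rule integral_mult_right_zero)
  finally show ?thesis .
qed

text \<open>The factors 4 anticipate \<open>ennreal_add_power2_le\<close>. Extending the window to
  the whole line makes the majorant free of \<open>t\<close>.\<close>

definition Z :: "real^2 \<Rightarrow> ennreal" where
  "Z x = (\<integral>\<^sup>+s. 4 * (ennreal (1 / R) * b1.M R s x)\<^sup>2 + 4 * (b2.M R s x)\<^sup>2 \<partial>lborel)"

text \<open>After Duhamel's formula and Fubini, the contribution of time \<open>s\<close> is the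
  data \<open>V1 s\<close> and \<open>V2 s\<close> evolved for the remaining time
  \<open>t - s\<close>, hence bounded by the maximal functions over \<open>{0<..<R}\<close>.\<close>

lemma propagate_V1_bound: "(ennreal (cmod (propagate \<alpha> (V1 t) x 0)))\<^sup>2 \<le> ennreal R * Z x"
proof -
  let ?g = "\<lambda>s \<xi>. complex_of_real (1 / R) * V1 s \<xi> + \<i> * complex_of_real ((s - t + R) / R) * V2 s \<xi>"
  let ?K = "\<lambda>s \<xi>. cis (x \<bullet> \<xi>) * (indicator {t - R..t} s *\<^sub>R (cis ((t - s) * norm \<xi> powr \<alpha>) * ?g s \<xi>))"
  let ?F = "\<lambda>s. LINT \<xi>|lborel. ?K s \<xi>"
  define B where "B = (LINT \<eta>|lborel. cmod (h \<eta>))"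
  have "integrable lborel (indicator (cball (0::real^2) 3) :: _ \<Rightarrow> real)"
    using emeasure_lborel_cball_finite[of "0::real^2" 3] by (intro integrable_real_indicator) auto
  note dom = pair_mult_integrable[OF window_integrable integrable_mult_right[OF this, of "1 / R * (1 * B) + L * r * B"]]
  have B: "B \<ge> 0" by (simp add: B_def)
  have K: "integrable (lborel \<Otimes>\<^sub>M lborel) (\<lambda>(s, \<xi>). ?K s \<xi>)"
  proof (rule Bochner_Integration.integrable_bound[OF dom])
    show "(\<lambda>(s, \<xi>). ?K s \<xi>) \<in> borel_measurable (lborel \<Otimes>\<^sub>M lborel)" by measurable
    have "norm (?K s \<xi>) \<le> norm (indicator {t - R..t} s * ((1 / R * (1 * B) + L * r * B) * indicator (cball (0::real^2) 3) \<xi>))" for s \<xi>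
    proof (cases "s \<in> {t - R..t} \<and> norm \<xi> \<le> 3")
      case True
      have le1: "\<bar>(s - t + R) / R\<bar> \<le> 1" using True R by (auto simp: abs_le_iff field_simps)
      have "cmod (?g s \<xi>) \<le> 1 / R * cmod (V1 s \<xi>) + \<bar>(s - t + R) / R\<bar> * cmod (V2 s \<xi>)"
        using R by (intro order_trans[OF norm_triangle_ineq]) (simp only: norm_mult norm_of_real norm_ii mult_1_left abs_divide; simp)
      also have "\<dots> \<le> 1 / R * (1 * B) + 1 * (L * r * B)"
        using R le1 b1.localized_bound[of s \<xi>] b2.localized_bound[of s \<xi>] unfolding B_def
        by (intro add_mono mult_mono) auto
      finally have "cmod (?g s \<xi>) \<le> \<bar>1 / R * (1 * B) + L * r * B\<bar>" by simp
      then show ?thesis using True by (simp add: norm_mult)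
    next
      case False
      then have "s \<notin> {t - R..t} \<or> (V1 s \<xi> = 0 \<and> V2 s \<xi> = 0)"
        using b1.localized_eq_0[of \<xi> s] b2.localized_eq_0[of \<xi> s] by auto
      then show ?thesis by auto
    qed
    then show "AE p in lborel \<Otimes>\<^sub>M lborel. norm (case p of (s, \<xi>) \<Rightarrow> ?K s \<xi>)
        \<le> norm (indicator {t - R..t} (fst p) * ((1 / R * (1 * B) + L * r * B) * indicator (cball (0::real^2) 3) (snd p)))"
      by (intro AE_I2) (auto simp only: split_beta)
  qed
  have "propagate \<alpha> (V1 t) x 0 = (LINT \<xi>|lborel. LINT s|lborel. ?K s \<xi>)"
    unfolding propagate_def integral_mult_right_zero by (simp only: duhamel[of t] mult_zero_left add_0_right)
  also have "\<dots> = (LINT s|lborel. ?F s)"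
    by (rule lborel_pair.Fubini_integral[OF K])
  finally have eq: "propagate \<alpha> (V1 t) x 0 = (LINT s|lborel. ?F s)" .
  \<comment> \<open>The two endpoints are excluded because the maximal functions use the open
    interval; they form a null set in \<open>s\<close>.\<close>
  have Fb: "ennreal (cmod (?F s)) \<le> (ennreal (1 / R) * b1.M R s x + b2.M R s x) * indicator {t - R..t} s"
    if "s \<noteq> t" "s \<noteq> t - R" for s
  proof (cases "s \<in> {t - R..t}")
    case True
    then have u: "t - s \<in> {0<..<R}" using that by auto
    have le1: "\<bar>(s - t + R) / R\<bar> \<le> 1" using True R by (auto simp: abs_le_iff field_simps)
    let ?W1 = "propagate \<alpha> (V1 s) x (t - s)" and ?W2 = "propagate \<alpha> (V2 s) x (t - s)"
    have "?F s = (LINT \<xi>|lborel. complex_of_real (1 / R) * (cis (x \<bullet> \<xi> + (t - s) * norm \<xi> powr \<alpha>) * V1 s \<xi>)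
       + \<i> * complex_of_real ((s - t + R) / R) * (cis (x \<bullet> \<xi> + (t - s) * norm \<xi> powr \<alpha>) * V2 s \<xi>))"
      using True by (intro Bochner_Integration.integral_cong refl)
         (simp only: cis_mult[symmetric] indicator_simps scaleR_one distrib_left mult_ac)
    also have "\<dots> = complex_of_real (1 / R) * ?W1 + \<i> * complex_of_real ((s - t + R) / R) * ?W2"
      unfolding propagate_def integral_mult_right_zero[symmetric]
      by (intro Bochner_Integration.integral_add integrable_mult_right integrable_cis_mult
          b1.localized_integrable b2.localized_integrable; measurable)
    finally have "cmod (?F s) \<le> 1 / R * cmod ?W1 + \<bar>(s - t + R) / R\<bar> * cmod ?W2"
      using R norm_triangle_ineq[of "complex_of_real (1 / R) * ?W1" "\<i> * complex_of_real ((s - t + R) / R) * ?W2"]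
      by (simp only: norm_mult norm_of_real norm_ii mult_1_left abs_divide; simp)
    also have "\<dots> \<le> 1 / R * cmod ?W1 + 1 * cmod ?W2"
      using le1 by (intro add_left_mono mult_right_mono) auto
    finally have "ennreal (cmod (?F s)) \<le> ennreal (1 / R * cmod ?W1 + 1 * cmod ?W2)"
      by (rule ennreal_leI)
    also have "\<dots> = ennreal (1 / R) * ennreal (cmod ?W1) + ennreal (cmod ?W2)"
      using R by (subst ennreal_mult[symmetric]) (simp_all add: ennreal_plus)
    also have "\<dots> \<le> ennreal (1 / R) * b1.M R s x + b2.M R s x"
      unfolding b1.M_def b2.M_def by (intro add_mono mult_left_mono SUP_upper u; simp)
    finally show ?thesis using True by simp
  qed simp
  have "ennreal (cmod (LINT s|lborel. ?F s)) \<le> (\<integral>\<^sup>+s. ennreal (cmod (?F s)) \<partial>lborel)"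
    by (rule integral_norm_bound_ennreal[OF lborel_pair.integrable_fst[OF K]])
  also have "\<dots> \<le> (\<integral>\<^sup>+s. (ennreal (1 / R) * b1.M R s x + b2.M R s x) * indicator {t - R..t} s \<partial>lborel)"
  proof (rule nn_integral_mono_AE)
    have "AE s in lborel. s \<noteq> t" "AE s in lborel. s \<noteq> t - R" by (rule AE_lborel_singleton)+
    then show "AE s in lborel. ennreal (cmod (?F s)) \<le> (ennreal (1 / R) * b1.M R s x + b2.M R s x) * indicator {t - R..t} s"
      by eventually_elim (rule Fb)
  qed
  finally have "(ennreal (cmod (LINT s|lborel. ?F s)))\<^sup>2
      \<le> (\<integral>\<^sup>+s. (ennreal (1 / R) * b1.M R s x + b2.M R s x) * indicator {t - R..t} s \<partial>lborel)\<^sup>2"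
    by (rule power_mono) simp
  \<comment> \<open>Cauchy-Schwarz against the indicator of the window, whose squared norm is its
    length \<open>R\<close>.\<close>
  also have "\<dots> \<le> (\<integral>\<^sup>+s. (ennreal (1 / R) * b1.M R s x + b2.M R s x)\<^sup>2 \<partial>lborel) * (\<integral>\<^sup>+s. (indicator {t - R..t} s)\<^sup>2 \<partial>lborel)"
    by (rule Cauchy_Schwarz_nn_integral) measurable
  also have "(\<integral>\<^sup>+s. (indicator {t - R..t} s)\<^sup>2 \<partial>lborel) = (\<integral>\<^sup>+s. indicator {t - R..t} s \<partial>lborel)"
    by (intro nn_integral_cong) (auto split: split_indicator)
  also have "\<dots> = ennreal R" using R by simp
  also have "(\<integral>\<^sup>+s. (ennreal (1 / R) * b1.M R s x + b2.M R s x)\<^sup>2 \<partial>lborel) \<le> Z x"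
    unfolding Z_def by (intro nn_integral_mono ennreal_add_power2_le)
  finally show ?thesis unfolding eq by (simp add: mult.commute mult_right_mono)
qed

text \<open>Divides \<open>propagate_V1\<close> by the spatial weight, which is at least
  \<open>pi * r\<^sup>2 / 16\<close> on the ball; squaring gives
  \<open>256 / (pi\<^sup>2 * r ^ 4)\<close>.\<close>

lemma propagate_bound:
  assumes "x \<in> ball 0 R"
  shows "(ennreal (cmod (propagate \<alpha> h x t)))\<^sup>2 \<le> ennreal (256 * R / (pi\<^sup>2 * r ^ 4)) * Z x"
proof -
  let ?\<psi> = "LINT z|lborel. cis (x \<bullet> z) * complex_of_real (tent r z)"
  have "norm x * r \<le> R * r" using assms r by (intro mult_right_mono) auto
  also have "\<dots> \<le> 1" using R by (simp add: r_def)
  finally have "pi * r\<^sup>2 / 16 \<le> cmod ?\<psi>" by (intro tent_fourier_ge r)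
  then have "pi * r\<^sup>2 / 16 * cmod (propagate \<alpha> h x t) \<le> cmod ?\<psi> * cmod (propagate \<alpha> h x t)"
    by (rule mult_right_mono) simp
  also have "\<dots> = cmod (propagate \<alpha> (V1 t) x 0)" unfolding propagate_V1 by (simp add: norm_mult)
  finally have "cmod (propagate \<alpha> h x t) \<le> 16 / (pi * r\<^sup>2) * cmod (propagate \<alpha> (V1 t) x 0)"
    using r by (simp add: field_simps)
  then have "(ennreal (cmod (propagate \<alpha> h x t)))\<^sup>2 \<le> (ennreal (16 / (pi * r\<^sup>2)) * ennreal (cmod (propagate \<alpha> (V1 t) x 0)))\<^sup>2"
    by (intro power_mono) (auto simp: ennreal_mult[symmetric] intro!: ennreal_leI)
  also have "\<dots> \<le> (ennreal (16 / (pi * r\<^sup>2)))\<^sup>2 * (ennreal R * Z x)"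
    unfolding power_mult_distrib by (intro mult_left_mono propagate_V1_bound) auto
  also have "\<dots> = ennreal ((16 / (pi * r\<^sup>2))\<^sup>2 * R) * Z x"
    using R by (subst ennreal_mult) (auto simp: mult.assoc ennreal_power)
  also have "(16 / (pi * r\<^sup>2))\<^sup>2 * R = 256 * R / (pi\<^sup>2 * r ^ 4)"
    by (simp add: power_divide power_mult_distrib flip: power_mult)
  finally show ?thesis .
qed

text \<open>\<open>c\<close> is the squared constant of the hypothesis at the same \<open>R\<close>;
  it is lost only up to a factor depending on \<open>\<alpha>\<close>. The set \<open>I\<close> of
  times is arbitrary because \<open>Z\<close> does not involve \<open>t\<close>.\<close>

lemma maximal_energy:
  assumes hyp: "\<And>f. f \<in> L2 \<Longrightarrow> ess_supp (fourier f) \<subseteq> {\<xi>. 3/8 \<le> norm \<xi> \<and> norm \<xi> \<le> 17/8} \<Longrightarrow>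
    (\<integral>\<^sup>+x. (maximal_T \<alpha> f R x)\<^sup>2 * indicator (ball 0 R) x \<partial>lborel) \<le> c * energy f"
  shows "(\<integral>\<^sup>+x. (SUP t\<in>I. ennreal (cmod (propagate \<alpha> h x t)))\<^sup>2 * indicator (ball 0 R) x \<partial>lborel)
    \<le> ennreal (16384 * 8 powr \<alpha> * pi * (64 + L\<^sup>2)) * (c * energy h)"
proof -
  let ?B = "\<lambda>x. indicator (ball 0 R) x :: ennreal"
  let ?q = "256 * R / (pi\<^sup>2 * r ^ 4)"
  let ?C = "128 * 8 powr \<alpha> * pi ^ 3"
  have [measurable]: "(\<lambda>x. Z x) \<in> borel_measurable borel" unfolding Z_def by measurable
  have Bm[measurable]: "?B \<in> borel_measurable borel" by (intro borel_measurable_indicator) auto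
  have "(\<integral>\<^sup>+x. (SUP t\<in>I. ennreal (cmod (propagate \<alpha> h x t)))\<^sup>2 * ?B x \<partial>lborel) \<le> (\<integral>\<^sup>+x. ennreal ?q * (Z x * ?B x) \<partial>lborel)"
  proof (intro nn_integral_mono)
    fix x
    show "(SUP t\<in>I. ennreal (cmod (propagate \<alpha> h x t)))\<^sup>2 * ?B x \<le> ennreal ?q * (Z x * ?B x)"
    proof (cases "x \<in> ball 0 R")
      case True
      have "(SUP t\<in>I. ennreal (cmod (propagate \<alpha> h x t)))\<^sup>2 \<le> ennreal ?q * Z x"
        by (intro ennreal_SUP_power2_le propagate_bound True)
      then show ?thesis using True by simp
    qed simp
  qed
  also have "\<dots> = ennreal ?q * (\<integral>\<^sup>+x. \<integral>\<^sup>+s. (4 * (ennreal (1 / R) * b1.M R s x)\<^sup>2 + 4 * (b2.M R s x)\<^sup>2) * ?B x \<partial>lborel \<partial>lborel)"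
    unfolding Z_def by (subst nn_integral_cmult, measurable, subst nn_integral_multc) auto
  \<comment> \<open>Integrating in \<open>x\<close> first lets the hypothesis act at each fixed
    \<open>s\<close>. The exchange uses joint measurability of the maximal functions in time and
    space.\<close>
  also have "(\<integral>\<^sup>+x. \<integral>\<^sup>+s. (4 * (ennreal (1 / R) * b1.M R s x)\<^sup>2 + 4 * (b2.M R s x)\<^sup>2) * ?B x \<partial>lborel \<partial>lborel)
    = (\<integral>\<^sup>+s. \<integral>\<^sup>+x. (4 * (ennreal (1 / R) * b1.M R s x)\<^sup>2 + 4 * (b2.M R s x)\<^sup>2) * ?B x \<partial>lborel \<partial>lborel)"
    by (rule lborel_pair.Fubini') measurable
  also have "\<dots> \<le> (\<integral>\<^sup>+s. ennreal (4 / R\<^sup>2) * (c * energy (V1 s)) + 4 * (c * energy (V2 s)) \<partial>lborel)"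
  proof (intro nn_integral_mono)
    fix s
    have k: "4 * (ennreal (1 / R))\<^sup>2 = ennreal (4 / R\<^sup>2)"
      using R by (simp add: ennreal_power power_divide ennreal_mult[symmetric] flip: ennreal_numeral)
    have "(\<integral>\<^sup>+x. (4 * (ennreal (1 / R) * b1.M R s x)\<^sup>2 + 4 * (b2.M R s x)\<^sup>2) * ?B x \<partial>lborel)
       = (\<integral>\<^sup>+x. (4 * (ennreal (1 / R))\<^sup>2) * ((b1.M R s x)\<^sup>2 * ?B x) + 4 * ((b2.M R s x)\<^sup>2 * ?B x) \<partial>lborel)"
      by (intro nn_integral_cong) (simp add: distrib_left distrib_right power_mult_distrib mult_ac)
    also have "\<dots> = ennreal (4 / R\<^sup>2) * (\<integral>\<^sup>+x. (b1.M R s x)\<^sup>2 * ?B x \<partial>lborel) + 4 * (\<integral>\<^sup>+x. (b2.M R s x)\<^sup>2 * ?B x \<partial>lborel)"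
      unfolding k by (subst nn_integral_add, measurable, subst nn_integral_cmult, measurable, subst nn_integral_cmult) auto
    also have "\<dots> \<le> ennreal (4 / R\<^sup>2) * (c * energy (V1 s)) + 4 * (c * energy (V2 s))"
      by (intro add_mono mult_left_mono b1.M_energy b2.M_energy hyp) auto
    finally show "(\<integral>\<^sup>+x. (4 * (ennreal (1 / R) * b1.M R s x)\<^sup>2 + 4 * (b2.M R s x)\<^sup>2) * ?B x \<partial>lborel)
      \<le> ennreal (4 / R\<^sup>2) * (c * energy (V1 s)) + 4 * (c * energy (V2 s))" .
  qed
  also have "\<dots> = ennreal (4 / R\<^sup>2) * (c * (\<integral>\<^sup>+s. energy (V1 s) \<partial>lborel)) + 4 * (c * (\<integral>\<^sup>+s. energy (V2 s) \<partial>lborel))"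
    by (simp add: nn_integral_add nn_integral_cmult)
  also have "\<dots> \<le> ennreal (4 / R\<^sup>2) * (c * (ennreal (?C * 1\<^sup>2 * r ^ 3) * energy h)) + 4 * (c * (ennreal (?C * (L * r)\<^sup>2 * r ^ 3) * energy h))"
    by (intro add_mono mult_left_mono b1.localized_energy b2.localized_energy) auto
  also have "\<dots> = (ennreal (4 / R\<^sup>2) * ennreal (?C * 1\<^sup>2 * r ^ 3) + ennreal 4 * ennreal (?C * (L * r)\<^sup>2 * r ^ 3)) * (c * energy h)"
    by (simp only: distrib_left distrib_right mult_ac ennreal_numeral)
  also have "ennreal (4 / R\<^sup>2) * ennreal (?C * 1\<^sup>2 * r ^ 3) + ennreal 4 * ennreal (?C * (L * r)\<^sup>2 * r ^ 3)
     = ennreal (4 / R\<^sup>2 * (?C * 1\<^sup>2 * r ^ 3) + 4 * (?C * (L * r)\<^sup>2 * r ^ 3))"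
  proof -
    have "ennreal a * ennreal x + ennreal b * ennreal y = ennreal (a * x + b * y)"
      if "0 \<le> a" "0 \<le> x" "0 \<le> b" "0 \<le> y" for a b x y
      using that by (simp add: ennreal_mult ennreal_plus)
    from this[of "4 / R\<^sup>2" "?C * 1\<^sup>2 * r ^ 3" 4 "?C * (L * r)\<^sup>2 * r ^ 3"] show ?thesis
      using r by (simp only: mult_nonneg_nonneg zero_le_power2 divide_nonneg_nonneg zero_le_numeral zero_le_power less_imp_le powr_ge_zero pi_ge_zero)
  qed
  \<comment> \<open>Both contributions have order \<open>r ^ 5\<close>, since
    \<open>1 / R\<^sup>2 = 64 * r\<^sup>2\<close>; this is the origin of the 64.\<close>
  also have "4 / R\<^sup>2 * (?C * 1\<^sup>2 * r ^ 3) + 4 * (?C * (L * r)\<^sup>2 * r ^ 3) = 4 * ?C * (64 + L\<^sup>2) * r ^ 5"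
  proof -
    have "1 / R\<^sup>2 = 64 * r\<^sup>2" using R by (simp add: r_def field_simps power2_eq_square)
    then have "4 / R\<^sup>2 = 4 * (64 * r\<^sup>2)" by (metis mult.right_neutral times_divide_eq_right)
    then show ?thesis by (simp add: power_mult_distrib algebra_simps flip: power_add)
  qed
  finally have "(\<integral>\<^sup>+x. (SUP t\<in>I. ennreal (cmod (propagate \<alpha> h x t)))\<^sup>2 * ?B x \<partial>lborel)
      \<le> ennreal ?q * (ennreal (4 * ?C * (64 + L\<^sup>2) * r ^ 5) * (c * energy h))"
    by (simp add: mult_left_mono)
  also have "\<dots> = ennreal (?q * (4 * ?C * (64 + L\<^sup>2) * r ^ 5)) * (c * energy h)"
    using R r by (subst ennreal_mult) (auto simp: mult.assoc)
  also have "?q * (4 * ?C * (64 + L\<^sup>2) * r ^ 5) = 16384 * 8 powr \<alpha> * pi * (64 + L\<^sup>2)"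
  proof -
    \<comment> \<open>The powers of \<open>r\<close> collapse to the single product
      \<open>R * r = 1 / 8\<close>, so the constant is free of \<open>R\<close>.\<close>
    have "?q * (4 * ?C * (64 + L\<^sup>2) * r ^ 5) = (R * r) * (256 * 4 * 128) * 8 powr \<alpha> * pi * (64 + L\<^sup>2)"
      using r by (simp add: power2_eq_square power3_eq_cube eval_nat_numeral field_simps)
    also have "R * r = 1 / 8" using R by (simp add: r_def)
    finally show ?thesis by simp
  qed
  finally show ?thesis .
qed

end

section \<open>Conclusion for norms\<close>

lemma L2_norm_restrict_power2:
  "(L2_norm (restrict_space lborel (ball 0 R)) F)\<^sup>2 = (\<integral>\<^sup>+x. (F x)\<^sup>2 * indicator (ball 0 R) x \<partial>lborel)"
  unfolding L2_norm_power2 by (rule nn_integral_restrict_space) simp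

theorem lemma2p4:
  fixes \<alpha> :: real
  assumes "\<alpha> > 1"
    and "\<forall>\<epsilon>>0. \<exists>C>0. \<forall>\<^sub>F R in at_top. \<forall>f\<in>L2.
      ess_supp (fourier f) \<subseteq> {\<xi> :: real^2. 3/8 \<le> norm \<xi> \<and> norm \<xi> \<le> 17/8} \<longrightarrow>
      L2_norm (restrict_space lborel (ball 0 R)) (maximal_T \<alpha> f R)
        \<le> ennreal (C * R powr (3/8 + \<epsilon>)) * cL2_norm f"
  shows "\<forall>\<epsilon>>0. \<exists>C>0. \<forall>\<^sub>F R in at_top. \<forall>f\<in>L2.
      ess_supp (fourier f) \<subseteq> {\<xi> :: real^2. 1/2 \<le> norm \<xi> \<and> norm \<xi> \<le> 2} \<longrightarrow>
      L2_norm (restrict_space lborel (ball 0 R)) (maximal_T \<alpha> f (R powr \<alpha>))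
        \<le> ennreal (C * R powr (3/8 + \<epsilon>)) * cL2_norm f"
proof (intro allI impI)
  fix \<epsilon> :: real assume "\<epsilon> > 0"
  define p where "p = 3/8 + \<epsilon>"
  \<comment> \<open>The hypothesis is used with the same \<epsilon> and, below, at the same
    \<open>R\<close> as the conclusion; only the constant changes.\<close>
  obtain C where C: "C > 0" and hyp: "\<forall>\<^sub>F R in at_top. \<forall>f\<in>L2.
      ess_supp (fourier f) \<subseteq> {\<xi> :: real^2. 3/8 \<le> norm \<xi> \<and> norm \<xi> \<le> 17/8} \<longrightarrow>
      L2_norm (restrict_space lborel (ball 0 R)) (maximal_T \<alpha> f R)
        \<le> ennreal (C * R powr p) * cL2_norm f"
    using assms(2) \<open>\<epsilon> > 0\<close> unfolding p_def by blast
  define K where "K = 16384 * 8 powr \<alpha> * pi * (64 + (\<alpha> * 3 powr \<alpha>)\<^sup>2)"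
  define K' where "K' = K * (2 * (2 * pi)\<^sup>2)"
  have K: "K > 0" unfolding K_def by (intro mult_pos_pos add_pos_nonneg) auto
  then have K': "K' > 0" by (simp add: K'_def)
  have "\<forall>\<^sub>F R in at_top. \<forall>f\<in>L2.
      ess_supp (fourier f) \<subseteq> {\<xi> :: real^2. 1/2 \<le> norm \<xi> \<and> norm \<xi> \<le> 2} \<longrightarrow>
      L2_norm (restrict_space lborel (ball 0 R)) (maximal_T \<alpha> f (R powr \<alpha>))
        \<le> ennreal (C * sqrt K' * R powr p) * cL2_norm f"
    using hyp eventually_ge_at_top[of 1]
  proof eventually_elim
    case (elim R)
    show ?case
    proof (intro ballI impI)
      fix f :: "real^2 \<Rightarrow> complex"
      assume f: "f \<in> L2" and supp: "ess_supp (fourier f) \<subseteq> {\<xi>. 1/2 \<le> norm \<xi> \<and> norm \<xi> \<le> 2}"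
      note F = has_fourier_transform_exists[OF f]
      have [measurable]: "fourier f \<in> borel_measurable borel"
        using F by (simp add: has_fourier_transform_iff L2_iff)
      \<comment> \<open>The support condition gives vanishing off the annulus only almost
        everywhere; cutting off yields the pointwise vanishing that the locale demands, and does not
        change \<open>T\<close>.\<close>
      define h where "h = (\<lambda>\<xi>. if 1/2 \<le> norm \<xi> \<and> norm \<xi> \<le> 2 then fourier f \<xi> else 0)"
      have hm: "h \<in> borel_measurable borel" unfolding h_def by measurable
      have fh: "AE \<xi> in lborel. fourier f \<xi> = h \<xi>"
        using AE_zero_off_ess_supp[of "fourier f"] by eventually_elim (use supp in \<open>auto simp: h_def\<close>)
      have "energy h \<le> energy (fourier f)"
        by (intro nn_integral_mono ennreal_leI) (auto simp: h_def)
      also have "\<dots> \<le> ennreal (2 * (2 * pi) ^ DIM(real^2)) * energy f"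
        by (rule energy_has_fourier_transform[OF f F])
      finally have he: "energy h \<le> ennreal (2 * (2 * pi)\<^sup>2) * energy f" by simp
      interpret time_localization \<alpha> R h
      proof
        show "energy h < \<infinity>"
          using f by (intro le_less_trans[OF he]) (auto simp: L2_iff ennreal_mult_less_top)
      qed (use assms(1) elim hm in \<open>auto simp: h_def split: if_splits\<close>)
      let ?c = "(ennreal (C * R powr p))\<^sup>2"
      have "(L2_norm (restrict_space lborel (ball 0 R)) (maximal_T \<alpha> f (R powr \<alpha>)))\<^sup>2
          = (\<integral>\<^sup>+x. (SUP t\<in>{0<..<R powr \<alpha>}. ennreal (cmod (propagate \<alpha> h x t)))\<^sup>2 * indicator (ball 0 R) x \<partial>lborel)"
        unfolding L2_norm_restrict_power2 by (simp add: maximal_T_def T_eq_propagate[OF fh f hm])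
      also have "\<dots> \<le> ennreal (16384 * 8 powr \<alpha> * pi * (64 + L\<^sup>2)) * (?c * energy h)"
      proof (rule maximal_energy)
        fix g :: "real^2 \<Rightarrow> complex"
        assume "g \<in> L2" "ess_supp (fourier g) \<subseteq> {\<xi>. 3/8 \<le> norm \<xi> \<and> norm \<xi> \<le> 17/8}"
        then have "L2_norm (restrict_space lborel (ball 0 R)) (maximal_T \<alpha> g R) \<le> ennreal (C * R powr p) * cL2_norm g"
          using elim by blast
        then have "(L2_norm (restrict_space lborel (ball 0 R)) (maximal_T \<alpha> g R))\<^sup>2 \<le> (ennreal (C * R powr p) * cL2_norm g)\<^sup>2"
          by (rule power_mono) simp
        then show "(\<integral>\<^sup>+x. (maximal_T \<alpha> g R x)\<^sup>2 * indicator (ball 0 R) x \<partial>lborel) \<le> ?c * energy g"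
          unfolding L2_norm_restrict_power2 power_mult_distrib cL2_norm_power2 .
      qed
      also have "\<dots> \<le> ennreal K * (?c * (ennreal (2 * (2 * pi)\<^sup>2) * energy f))"
        unfolding K_def L_def by (intro mult_left_mono he) auto
      also have "\<dots> = (ennreal K * ennreal (2 * (2 * pi)\<^sup>2)) * ?c * energy f" by (simp only: mult_ac)
      \<comment> \<open>The estimate was made for squares, so the new constant is a square root.
        \<open>K'\<close> combines \<open>K\<close> with the bound of \<open>energy h\<close> by
        \<open>energy f\<close>.\<close>
      also have "ennreal K * ennreal (2 * (2 * pi)\<^sup>2) = (ennreal (sqrt K'))\<^sup>2"
        using K K' by (simp add: K'_def ennreal_mult[symmetric] ennreal_power)
      also have "(ennreal (sqrt K'))\<^sup>2 * ?c * energy f = (ennreal (sqrt K') * ennreal (C * R powr p) * cL2_norm f)\<^sup>2"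
        unfolding cL2_norm_power2[symmetric] power_mult_distrib ..
      also have "ennreal (sqrt K') * ennreal (C * R powr p) = ennreal (C * sqrt K' * R powr p)"
        using C K' by (subst ennreal_mult[symmetric]) (auto simp: mult_ac)
      finally show "L2_norm (restrict_space lborel (ball 0 R)) (maximal_T \<alpha> f (R powr \<alpha>))
          \<le> ennreal (C * sqrt K' * R powr p) * cL2_norm f"
        unfolding ennreal_power2_le_iff .
    qed
  qed
  then show "\<exists>C>0. \<forall>\<^sub>F R in at_top. \<forall>f\<in>L2.
      ess_supp (fourier f) \<subseteq> {\<xi> :: real^2. 1/2 \<le> norm \<xi> \<and> norm \<xi> \<le> 2} \<longrightarrow>
      L2_norm (restrict_space lborel (ball 0 R)) (maximal_T \<alpha> f (R powr \<alpha>))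
        \<le> ennreal (C * R powr (3/8 + \<epsilon>)) * cL2_norm f"
    using C K' unfolding p_def by (intro exI[of _ "C * sqrt K'"]) auto
qed

end
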